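(* Let $\mathbb{T}/\mathcal{I}$ be the free Hom-associative algebra with $1$-generator, with the product $\vee$, the endomorphism $\alpha$, the unit $\mathbf{1}$, the coproduct $\Delta$ and the counit $\epsilon$ induced from $\mathbb{T}$. Then $\mathbb{T}/\mathcal{I}$ is an $(\alpha,\mathrm{id})$-Hom-Hopf algebra when equipped with the antipode $S$ induced from the map $S:\mathbb{T}\to\mathbb{T}$.
   Context: $\mathbb{K}$ is a field, $\mathbb{N}=\{0,1,2,\dots\}$. Trees. For $n\ge 1$, $T_n$ is the set of planar binary rooted trees with $n$ leaves (labelled $1,\dots,n$ from left to right); $T_1=\{|\}$. For $\varphi\in T_p,\psi\in T_q$ the grafting $\varphi\vee\psi\in T_{p+q}$ is obtained by joining the roots of $\varphi$ (left) and $\psi$ (right) to a new root; every tree with $n\ge2$ leaves is uniquely of this form. A leaf weighted $n$-tree is a pair $(\varphi,a)$ with $\varphi\in T_n$, $a\in\mathbb{N}^n$ ($a_i$ is the weight of leaf $i$); $B_n$ is the set of these. Grafting extends by $(\varphi,a)\vee(\psi,b)=(\varphi\vee\psi,(a,b))$. $B$ is the disjoint union of all $B_n$, $n\ge1$, and one further element $\mathbf{1}$; $\mathbb{T}$ is the $\mathbb{K}$-vector space with basis $B$. The linear map $\alpha:\mathbb{T}\to\mathbb{T}$ is given by $\alpha(\mathbf{1})=\mathbf{1}$ and $\alpha(\varphi,a_1,\dots,a_n)=(\varphi,a_1+1,\dots,a_n+1)$. The bilinear product $\vee$ on $\mathbb{T}$ is grafting on pairs of leaf weighted trees, with $\varphi\vee\mathbf{1}=\mathbf{1}\vee\varphi=\alpha(\varphi)$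 and $\mathbf{1}\vee\mathbf{1}=\mathbf{1}$. For $\varphi\in B_n$ and $I\subset\{1,\dots,n\}$, $\varphi_I\in B$ is obtained by replacing all leaves not in $I$ by $\mathbf{1}$ and evaluating the product $\vee$ (so $\varphi_\emptyset=\mathbf{1}$, $\varphi_{\{1,\dots,n\}}=\varphi$, and for $\varphi=\varphi_1\vee\varphi_2$ one has $\varphi_I=(\varphi_1)_{I_1}\vee(\varphi_2)_{I_2}$ with $I_1,I_2$ the parts of $I$ lying in the leaves of $\varphi_1$, $\varphi_2$). The coproduct is $\Delta\varphi=\sum_{I\sqcup J=\{1,\dots,n\}}\varphi_I\otimes\varphi_J$, $\Delta(\mathbf{1})=\mathbf{1}\otimes\mathbf{1}$; the counit is $\epsilon(\mathbf{1})=1$, $\epsilon(\varphi)=0$ for $\varphi\in B_n$. The linear map $S:\mathbb{T}\to\mathbb{T}$ is determined by $S(\mathbf{1})=\mathbf{1}$, $S(|,a_1)=-(|,a_1)$ for $a_1\in\mathbb N$, and $S(\varphi\vee\psi)=S(\psi)\vee S(\varphi)$. $\mathcal{I}\subset\mathbb{T}$ is the two-sided ideal for $\vee$ generated by all $(\phi\vee\psi)\vee\alpha(\chi)-\alpha(\phi)\vee(\psi\vee\chi)$ with $\phi,\psi,\chi\in B$. The quotient $\mathbb{T}/\mathcal{I}$ with the induced $\vee,\alpha,\mathbf{1}$ is the free Hom-associative algebra with $1$-generator; $\Delta,\epsilon,S$ also descend to it. Hom-Hopf algebras. A unital Hom-associative algebra $(A,\mu,\alpha,\eta)$ is a vector space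 with a bilinear product $\mu$, a linear $\alpha$ with $\alpha(\mu(x,y))=\mu(\alpha(x),\alpha(y))$, $\mu(\alpha(x),\mu(y,z))=\mu(\mu(x,y),\alpha(z))$, and a linear $\eta:\mathbb{K}\to A$ such that, for $\mathbf{1}=\eta(1)$, $\mu(x,\mathbf{1})=\mu(\mathbf{1},x)=\alpha(x)$ and $\alpha(\mathbf{1})=\mathbf{1}$. A counital Hom-coassociative coalgebra $(A,\Delta,\beta,\epsilon)$ consists of linear maps $\Delta:A\to A\otimes A$, $\beta:A\to A$, $\epsilon:A\to\mathbb{K}$ with $(\beta\otimes\Delta)\circ\Delta=(\Delta\otimes\beta)\circ\Delta$, $(\mathrm{id}\otimes\epsilon)\circ\Delta=\beta=(\epsilon\otimes\mathrm{id})\circ\Delta$, $\epsilon\circ\beta=\epsilon$. An $(\alpha,\beta)$-Hom-bialgebra $(A,\mu,\alpha,\eta,\Delta,\beta,\epsilon)$ is both, with $\Delta(\mu(x,y))=\Delta(x)\cdot\Delta(y)$ (componentwise product on $A\otimes A$), $\Delta(\mathbf{1})=\mathbf{1}\otimes\mathbf{1}$, $\epsilon(\mathbf{1})=1$, $\epsilon(\mu(x,y))=\epsilon(x)\epsilon(y)$, $\epsilon\circ\alpha=\epsilon$. Convolution: $f\star g=\mu\circ(f\otimes g)\circ\Delta$. An antipode is a linear map $S:A\to A$ with $S(\mu(x,y))=\mu(S(y),S(x))$, $S\circ\alpha=\alpha\circ S$, $S\circ\eta=\eta$, $\epsilon\circ S=\epsilon$, and such that for every $x\in A$ there is $k\in\mathbb{N}$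 (depending on $x$) with $\alpha^k((S\star\mathrm{id})(x))=\alpha^k((\mathrm{id}\star S)(x))=\eta\circ\epsilon(x)$. An $(\alpha,\beta)$-Hom-Hopf algebra is an $(\alpha,\beta)$-Hom-bialgebra admitting an antipode. *)

theory Defs
  imports Complex_Main "HOL-Library.Poly_Mapping"
begin

section \<open>Free vector spaces\<close>

text \<open>The free vector space over the field \<open>'k\<close> on the set of all elements of the type \<open>'x\<close> is the
  type \<open>'x \<Rightarrow>\<^sub>0 'k\<close> of finitely supported functions.\<close>

definition pscale :: "'k::field \<Rightarrow> ('x \<Rightarrow>\<^sub>0 'k) \<Rightarrow> ('x \<Rightarrow>\<^sub>0 'k)"
  where "pscale c u = Poly_Mapping.map ((*) c) u"

abbreviation gen :: "'x \<Rightarrow> ('x \<Rightarrow>\<^sub>0 'k::field)"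
  where "gen x \<equiv> Poly_Mapping.single x 1"

text \<open>The linear extension of a map on the basis, with values in a vector space with scalar
  multiplication \<open>s\<close>.\<close>

definition lin_ext :: "('k::field \<Rightarrow> 'v::ab_group_add \<Rightarrow> 'v) \<Rightarrow> ('x \<Rightarrow> 'v) \<Rightarrow> ('x \<Rightarrow>\<^sub>0 'k) \<Rightarrow> 'v"
  where "lin_ext s f u = (\<Sum>x\<in>Poly_Mapping.keys u. s (Poly_Mapping.lookup u x) (f x))"

lemma lookup_pscale [simp]: "Poly_Mapping.lookup (pscale c u) x = c * Poly_Mapping.lookup u x"
  by (simp add: pscale_def map.rep_eq when_def)

lemma vector_space_pscale: "vector_space (pscale :: 'k::field \<Rightarrow> ('x \<Rightarrow>\<^sub>0 'k) \<Rightarrow> _)"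
  by unfold_locales (auto intro!: poly_mapping_eqI simp: lookup_add algebra_simps)

interpretation pm: vector_space "pscale :: 'k::field \<Rightarrow> ('x \<Rightarrow>\<^sub>0 'k) \<Rightarrow> _"
  by (rule vector_space_pscale)

lemma pscale_gen: "pscale c (gen x) = Poly_Mapping.single x c"
  by (rule poly_mapping_eqI) (simp add: lookup_single when_def)

lemma lin_ext_superset:
  assumes "vector_space s" "finite A" "Poly_Mapping.keys u \<subseteq> A"
  shows "lin_ext s f u = (\<Sum>x\<in>A. s (Poly_Mapping.lookup u x) (f x))"
proof -
  interpret vector_space s by fact
  show ?thesis unfolding lin_ext_def
    by (rule sum.mono_neutral_left) (use assms in \<open>auto simp: in_keys_iff\<close>)
qed

lemma linear_lin_ext:
  assumes "vector_space s"
  shows "Vector_Spaces.linear pscale s (lin_ext s f)"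
proof -
  interpret v: vector_space s by fact
  have "lin_ext s f (u + w) = lin_ext s f u + lin_ext s f w" for u w
  proof -
    let ?A = "Poly_Mapping.keys u \<union> Poly_Mapping.keys w \<union> Poly_Mapping.keys (u + w)"
    have "lin_ext s f x = (\<Sum>i\<in>?A. s (Poly_Mapping.lookup x i) (f i))" if "x \<in> {u, w, u + w}" for x
      by (rule lin_ext_superset) (use assms that in auto)
    then show ?thesis
      by (simp add: lookup_add v.scale_left_distrib sum.distrib)
  qed
  moreover have "lin_ext s f (pscale c u) = s c (lin_ext s f u)" for c u
  proof -
    have "lin_ext s f (pscale c u)
        = (\<Sum>i\<in>Poly_Mapping.keys u. s (Poly_Mapping.lookup (pscale c u) i) (f i))"
      by (rule lin_ext_superset) (use assms in \<open>auto simp: in_keys_iff\<close>)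
    then show ?thesis
      by (simp add: lin_ext_def v.scale_sum_right)
  qed
  ultimately show ?thesis
    unfolding Vector_Spaces.linear_iff using assms vector_space_pscale by blast
qed

lemma lin_ext_gen:
  assumes "vector_space s"
  shows "lin_ext s f (gen x) = f x"
proof -
  interpret v: vector_space s by fact
  show ?thesis by (simp add: lin_ext_def)
qed

lemma lin_ext_gen_id: "lin_ext pscale gen u = u"
proof (rule poly_mapping_eqI)
  fix k
  have "Poly_Mapping.lookup (lin_ext pscale gen u) k
      = (\<Sum>x\<in>Poly_Mapping.keys u. Poly_Mapping.lookup u x * (1 when x = k))"
    by (simp add: lin_ext_def lookup_sum lookup_single)
  also have "\<dots> = (\<Sum>x\<in>Poly_Mapping.keys u. if x = k then Poly_Mapping.lookup u x else 0)"
    by (rule sum.cong) (simp_all add: when_def)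
  also have "\<dots> = Poly_Mapping.lookup u k"
    by (simp add: in_keys_iff)
  finally show "Poly_Mapping.lookup (lin_ext pscale gen u) k = Poly_Mapping.lookup u k" .
qed

lemma linear_gen_expand:
  assumes "Vector_Spaces.linear pscale s f"
  shows "f u = lin_ext s (\<lambda>x. f (gen x)) u"
proof -
  interpret Vector_Spaces.linear pscale s f by fact
  have "f u = f (lin_ext pscale gen u)" by (simp add: lin_ext_gen_id)
  also have "\<dots> = lin_ext s (\<lambda>x. f (gen x)) u"
    unfolding lin_ext_def by (simp only: sum scale)
  finally show ?thesis .
qed

lemma linear_gen_eqI:
  assumes "Vector_Spaces.linear pscale s f" "Vector_Spaces.linear pscale s g"
    and "\<And>x. f (gen x) = g (gen x)"
  shows "f u = g u"
  unfolding linear_gen_expand[OF assms(1), of u] linear_gen_expand[OF assms(2), of u]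
  by (simp only: assms(3))

lemma linear_gen_subspaceI:
  assumes "Vector_Spaces.linear pscale s f" "module.subspace s N" "\<And>x. f (gen x) \<in> N"
  shows "f u \<in> N"
proof -
  interpret Vector_Spaces.linear pscale s f by fact
  have "f u = lin_ext s (\<lambda>x. f (gen x)) u" by (rule linear_gen_expand[OF assms(1)])
  also have "\<dots> \<in> N" unfolding lin_ext_def
    by (intro vs2.subspace_sum vs2.subspace_scale assms)
  finally show ?thesis .
qed

section \<open>Tensor products\<close>

text \<open>All tensor products are formed over \<open>'k\<close>. A vector space is an abelian group type with a scalar
  multiplication \<open>s\<close> such that \<^term>\<open>vector_space s\<close>. Its second (third) tensor power is the quotient of
  the free vector space on pairs (triples) of vectors by the relations of linearity in each
  argument; its elements are cosets. The pure tensor of \<open>x\<close> and \<open>y\<close> is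
  \<open>coset (tensor_rel s) (gen (x, y))\<close>.\<close>

definition slot_rel :: "('k::field \<Rightarrow> 'a::ab_group_add \<Rightarrow> 'a) \<Rightarrow> ('a \<Rightarrow> 'x) \<Rightarrow> ('x \<Rightarrow>\<^sub>0 'k) set"
  where "slot_rel s f = {gen (f (x + y)) - gen (f x) - gen (f y) |x y. True}
    \<union> {gen (f (s c x)) - pscale c (gen (f x)) |c x. True}"

definition tensor_rel :: "('k::field \<Rightarrow> 'a::ab_group_add \<Rightarrow> 'a) \<Rightarrow> (('a \<times> 'a) \<Rightarrow>\<^sub>0 'k) set"
  where "tensor_rel s = module.span pscale
    ((\<Union>y. slot_rel s (\<lambda>x. (x, y))) \<union> (\<Union>x. slot_rel s (\<lambda>y. (x, y))))"

definition tensor3_rel :: "('k::field \<Rightarrow> 'a::ab_group_add \<Rightarrow> 'a) \<Rightarrow> (('a \<times> 'a \<times> 'a) \<Rightarrow>\<^sub>0 'k) set"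
  where "tensor3_rel s = module.span pscale
    ((\<Union>y z. slot_rel s (\<lambda>x. (x, y, z))) \<union> (\<Union>x z. slot_rel s (\<lambda>y. (x, y, z)))
      \<union> (\<Union>x y. slot_rel s (\<lambda>z. (x, y, z))))"

definition coset :: "('x \<Rightarrow>\<^sub>0 'k::field) set \<Rightarrow> ('x \<Rightarrow>\<^sub>0 'k) \<Rightarrow> ('x \<Rightarrow>\<^sub>0 'k) set"
  where "coset N u = {v. v - u \<in> N}"

text \<open>Maps out of a tensor product are given on a representative of the coset. In all uses below they
  come from multilinear maps and hence do not depend on this choice.\<close>

definition rep :: "('x \<Rightarrow>\<^sub>0 'k::field) set \<Rightarrow> ('x \<Rightarrow>\<^sub>0 'k)"
  where "rep X = (SOME u. u \<in> X)"

abbreviation tensor :: "('k::field \<Rightarrow> 'a::ab_group_add \<Rightarrow> 'a) \<Rightarrow> 'a \<Rightarrow> 'a \<Rightarrow> (('a \<times> 'a) \<Rightarrow>\<^sub>0 'k) set"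
  where "tensor s x y \<equiv> coset (tensor_rel s) (gen (x, y))"

definition tensor_space :: "('k::field \<Rightarrow> 'a::ab_group_add \<Rightarrow> 'a) \<Rightarrow> (('a \<times> 'a) \<Rightarrow>\<^sub>0 'k) set set"
  where "tensor_space s = range (coset (tensor_rel s))"

definition tensor_add :: "('k::field \<Rightarrow> 'a::ab_group_add \<Rightarrow> 'a) \<Rightarrow> (('a \<times> 'a) \<Rightarrow>\<^sub>0 'k) set
    \<Rightarrow> (('a \<times> 'a) \<Rightarrow>\<^sub>0 'k) set \<Rightarrow> (('a \<times> 'a) \<Rightarrow>\<^sub>0 'k) set"
  where "tensor_add s X Y = coset (tensor_rel s) (rep X + rep Y)"

definition tensor_scale :: "('k::field \<Rightarrow> 'a::ab_group_add \<Rightarrow> 'a) \<Rightarrow> 'k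
    \<Rightarrow> (('a \<times> 'a) \<Rightarrow>\<^sub>0 'k) set \<Rightarrow> (('a \<times> 'a) \<Rightarrow>\<^sub>0 'k) set"
  where "tensor_scale s c X = coset (tensor_rel s) (pscale c (rep X))"

text \<open>The linear map with \<open>x \<otimes> y \<mapsto> h x y\<close>, for bilinear \<open>h\<close> with values in a vector space with
  scalar multiplication \<open>s\<close>.\<close>

definition tensor_lift :: "('k::field \<Rightarrow> 'b::ab_group_add \<Rightarrow> 'b) \<Rightarrow> ('a \<Rightarrow> 'a \<Rightarrow> 'b)
    \<Rightarrow> (('a \<times> 'a) \<Rightarrow>\<^sub>0 'k) set \<Rightarrow> 'b"
  where "tensor_lift s h X = lin_ext s (\<lambda>(x, y). h x y) (rep X)"

text \<open>\<open>f \<otimes> g\<close>, where \<open>s\<close> is the scalar multiplication on the target.\<close>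

definition tensor_map :: "('k::field \<Rightarrow> 'b::ab_group_add \<Rightarrow> 'b) \<Rightarrow> ('a \<Rightarrow> 'b) \<Rightarrow> ('a \<Rightarrow> 'b)
    \<Rightarrow> (('a \<times> 'a) \<Rightarrow>\<^sub>0 'k) set \<Rightarrow> (('b \<times> 'b) \<Rightarrow>\<^sub>0 'k) set"
  where "tensor_map s f g X =
    coset (tensor_rel s) (lin_ext pscale (\<lambda>(x, y). gen (f x, g y)) (rep X))"

text \<open>Componentwise product: \<open>(x \<otimes> y) \<cdot> (x' \<otimes> y') = mul x x' \<otimes> mul y y'\<close>.\<close>

definition comp_mult :: "('a \<Rightarrow> 'a \<Rightarrow> 'a) \<Rightarrow> (('a \<times> 'a) \<Rightarrow>\<^sub>0 'k::field) \<Rightarrow> (('a \<times> 'a) \<Rightarrow>\<^sub>0 'k)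
    \<Rightarrow> (('a \<times> 'a) \<Rightarrow>\<^sub>0 'k)"
  where "comp_mult mul u v =
    lin_ext pscale (\<lambda>(x, y). lin_ext pscale (\<lambda>(x', y'). gen (mul x x', mul y y')) v) u"

definition tensor_mult :: "('k::field \<Rightarrow> 'a::ab_group_add \<Rightarrow> 'a) \<Rightarrow> ('a \<Rightarrow> 'a \<Rightarrow> 'a)
    \<Rightarrow> (('a \<times> 'a) \<Rightarrow>\<^sub>0 'k) set \<Rightarrow> (('a \<times> 'a) \<Rightarrow>\<^sub>0 'k) set \<Rightarrow> (('a \<times> 'a) \<Rightarrow>\<^sub>0 'k) set"
  where "tensor_mult s mul X Y = coset (tensor_rel s) (comp_mult mul (rep X) (rep Y))"

text \<open>\<open>f \<otimes> D\<close> and \<open>D \<otimes> f\<close> for a linear endomorphism \<open>f\<close> of a vector space and a linear map \<open>D\<close> from it to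
  its tensor square. Both take values in the third tensor power, with which the two iterated tensor
  products are identified as usual.\<close>

definition tensor_map_right :: "('k::field \<Rightarrow> 'a::ab_group_add \<Rightarrow> 'a) \<Rightarrow> ('a \<Rightarrow> 'a)
    \<Rightarrow> ('a \<Rightarrow> (('a \<times> 'a) \<Rightarrow>\<^sub>0 'k) set) \<Rightarrow> (('a \<times> 'a) \<Rightarrow>\<^sub>0 'k) set \<Rightarrow> (('a \<times> 'a \<times> 'a) \<Rightarrow>\<^sub>0 'k) set"
  where "tensor_map_right s f D X = coset (tensor3_rel s)
    (lin_ext pscale (\<lambda>(x, y). lin_ext pscale (\<lambda>(y1, y2). gen (f x, y1, y2)) (rep (D y))) (rep X))"

definition tensor_map_left :: "('k::field \<Rightarrow> 'a::ab_group_add \<Rightarrow> 'a) \<Rightarrow> ('a \<Rightarrow> (('a \<times> 'a) \<Rightarrow>\<^sub>0 'k) set)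
    \<Rightarrow> ('a \<Rightarrow> 'a) \<Rightarrow> (('a \<times> 'a) \<Rightarrow>\<^sub>0 'k) set \<Rightarrow> (('a \<times> 'a \<times> 'a) \<Rightarrow>\<^sub>0 'k) set"
  where "tensor_map_left s D f X = coset (tensor3_rel s)
    (lin_ext pscale (\<lambda>(x, y). lin_ext pscale (\<lambda>(x1, x2). gen (x1, x2, f y)) (rep (D x))) (rep X))"

section \<open>Hom-Hopf algebras\<close>

locale unital_hom_associative_algebra = vector_space scale
  for scale :: "'k::field \<Rightarrow> 'a::ab_group_add \<Rightarrow> 'a" +
  fixes mul :: "'a \<Rightarrow> 'a \<Rightarrow> 'a" and \<alpha> :: "'a \<Rightarrow> 'a" and \<eta> :: "'k \<Rightarrow> 'a"
  assumes linear_mul_left: "\<And>y. Vector_Spaces.linear scale scale (\<lambda>x. mul x y)"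
    and linear_mul_right: "\<And>x. Vector_Spaces.linear scale scale (mul x)"
    and linear_alpha: "Vector_Spaces.linear scale scale \<alpha>"
    and linear_eta: "Vector_Spaces.linear (*) scale \<eta>"
    and alpha_mul: "\<And>x y. \<alpha> (mul x y) = mul (\<alpha> x) (\<alpha> y)"
    and hom_assoc: "\<And>x y z. mul (\<alpha> x) (mul y z) = mul (mul x y) (\<alpha> z)"
    and mul_unit: "\<And>x. mul x (\<eta> 1) = \<alpha> x"
    and unit_mul: "\<And>x. mul (\<eta> 1) x = \<alpha> x"
    and alpha_unit: "\<alpha> (\<eta> 1) = \<eta> 1"

text \<open>In the counit axiom, the tensor products of \<open>A\<close> with the ground field are identified with \<open>A\<close> by
  \<open>x \<otimes> c \<mapsto> scale c x\<close> and \<open>c \<otimes> x \<mapsto> scale c x\<close>.\<close>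

locale counital_hom_coassociative_coalgebra = vector_space scale
  for scale :: "'k::field \<Rightarrow> 'a::ab_group_add \<Rightarrow> 'a" +
  fixes \<Delta> :: "'a \<Rightarrow> (('a \<times> 'a) \<Rightarrow>\<^sub>0 'k) set" and \<beta> :: "'a \<Rightarrow> 'a" and \<epsilon> :: "'a \<Rightarrow> 'k"
  assumes Delta_in: "\<And>x. \<Delta> x \<in> tensor_space scale"
    and Delta_add: "\<And>x y. \<Delta> (x + y) = tensor_add scale (\<Delta> x) (\<Delta> y)"
    and Delta_scale: "\<And>c x. \<Delta> (scale c x) = tensor_scale scale c (\<Delta> x)"
    and linear_beta: "Vector_Spaces.linear scale scale \<beta>"
    and linear_eps: "Vector_Spaces.linear scale (*) \<epsilon>"
    and hom_coassoc: "\<And>x. tensor_map_right scale \<beta> \<Delta> (\<Delta> x) = tensor_map_left scale \<Delta> \<beta> (\<Delta> x)"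
    and counit_right: "\<And>x. tensor_lift scale (\<lambda>y z. scale (\<epsilon> z) y) (\<Delta> x) = \<beta> x"
    and counit_left: "\<And>x. tensor_lift scale (\<lambda>y z. scale (\<epsilon> y) z) (\<Delta> x) = \<beta> x"
    and eps_beta: "\<And>x. \<epsilon> (\<beta> x) = \<epsilon> x"

locale hom_bialgebra =
  unital_hom_associative_algebra scale mul \<alpha> \<eta> +
  counital_hom_coassociative_coalgebra scale \<Delta> \<beta> \<epsilon>
  for scale :: "'k::field \<Rightarrow> 'a::ab_group_add \<Rightarrow> 'a"
    and mul :: "'a \<Rightarrow> 'a \<Rightarrow> 'a" and \<alpha> :: "'a \<Rightarrow> 'a" and \<eta> :: "'k \<Rightarrow> 'a"
    and \<Delta> :: "'a \<Rightarrow> (('a \<times> 'a) \<Rightarrow>\<^sub>0 'k) set" and \<beta> :: "'a \<Rightarrow> 'a" and \<epsilon> :: "'a \<Rightarrow> 'k" +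
  assumes Delta_mul: "\<And>x y. \<Delta> (mul x y) = tensor_mult scale mul (\<Delta> x) (\<Delta> y)"
    and Delta_unit: "\<Delta> (\<eta> 1) = tensor scale (\<eta> 1) (\<eta> 1)"
    and eps_unit: "\<epsilon> (\<eta> 1) = 1"
    and eps_mul: "\<And>x y. \<epsilon> (mul x y) = \<epsilon> x * \<epsilon> y"
    and eps_alpha: "\<And>x. \<epsilon> (\<alpha> x) = \<epsilon> x"
begin

definition convolution :: "('a \<Rightarrow> 'a) \<Rightarrow> ('a \<Rightarrow> 'a) \<Rightarrow> 'a \<Rightarrow> 'a"
  where "convolution f g = tensor_lift scale mul \<circ> tensor_map scale f g \<circ> \<Delta>"

definition antipode :: "('a \<Rightarrow> 'a) \<Rightarrow> bool"
  where "antipode S \<longleftrightarrow>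
    Vector_Spaces.linear scale scale S \<and>
    (\<forall>x y. S (mul x y) = mul (S y) (S x)) \<and>
    S \<circ> \<alpha> = \<alpha> \<circ> S \<and>
    S \<circ> \<eta> = \<eta> \<and>
    \<epsilon> \<circ> S = \<epsilon> \<and>
    (\<forall>x. \<exists>k::nat. (\<alpha> ^^ k) (convolution S id x) = \<eta> (\<epsilon> x) \<and>
      (\<alpha> ^^ k) (convolution id S x) = \<eta> (\<epsilon> x))"

end

locale hom_hopf_algebra = hom_bialgebra +
  assumes ex_antipode: "\<exists>S. antipode S"

section \<open>Leaf weighted trees\<close>

text \<open>A pair of a planar binary tree with \<open>n\<close> leaves and a vector of \<open>n\<close> weights is encoded as a tree whose
  leaves carry their weights.\<close>

datatype wtree = Leaf nat | Graft wtree wtree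

fun leaves :: "wtree \<Rightarrow> nat" where
  "leaves (Leaf a) = 1"
| "leaves (Graft s t) = leaves s + leaves t"

datatype basis = One | Tree wtree

fun wtree_alpha :: "wtree \<Rightarrow> wtree" where
  "wtree_alpha (Leaf a) = Leaf (a + 1)"
| "wtree_alpha (Graft s t) = Graft (wtree_alpha s) (wtree_alpha t)"

fun basis_alpha :: "basis \<Rightarrow> basis" where
  "basis_alpha One = One"
| "basis_alpha (Tree t) = Tree (wtree_alpha t)"

fun basis_vee :: "basis \<Rightarrow> basis \<Rightarrow> basis" where
  "basis_vee One b = basis_alpha b"
| "basis_vee (Tree s) One = Tree (wtree_alpha s)"
| "basis_vee (Tree s) (Tree t) = Tree (Graft s t)"

text \<open>\<open>restr t I\<close> replaces the leaves with number not in \<open>I\<close> by \<open>\<one>\<close>. The leaves of \<open>Graft s t\<close> numbered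
  \<open>leaves s + 1, \<dots>, leaves s + leaves t\<close> are the leaves \<open>1, \<dots>, leaves t\<close> of \<open>t\<close>.\<close>

fun restr :: "wtree \<Rightarrow> nat set \<Rightarrow> basis" where
  "restr (Leaf a) I = (if 1 \<in> I then Tree (Leaf a) else One)"
| "restr (Graft s t) I =
    basis_vee (restr s (I \<inter> {1..leaves s})) (restr t {i \<in> {1..leaves t}. leaves s + i \<in> I})"

type_synonym 'k TT = "basis \<Rightarrow>\<^sub>0 'k"

definition T_alpha :: "'k::field TT \<Rightarrow> 'k TT"
  where "T_alpha = lin_ext pscale (\<lambda>b. gen (basis_alpha b))"

definition T_vee :: "'k::field TT \<Rightarrow> 'k TT \<Rightarrow> 'k TT"
  where "T_vee x y = lin_ext pscale (\<lambda>b. lin_ext pscale (\<lambda>c. gen (basis_vee b c)) y) x"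

fun basis_Delta :: "basis \<Rightarrow> ('k::field TT \<times> 'k TT) \<Rightarrow>\<^sub>0 'k" where
  "basis_Delta One = gen (gen One, gen One)"
| "basis_Delta (Tree t) =
    (\<Sum>(I, J) \<in> {(I, J). I \<union> J = {1..leaves t} \<and> I \<inter> J = {}}. gen (gen (restr t I), gen (restr t J)))"

definition T_Delta :: "'k::field TT \<Rightarrow> (('k TT \<times> 'k TT) \<Rightarrow>\<^sub>0 'k) set"
  where "T_Delta x = coset (tensor_rel pscale) (lin_ext pscale basis_Delta x)"

definition T_eps :: "'k::field TT \<Rightarrow> 'k"
  where "T_eps = lin_ext (*) (\<lambda>b. case b of One \<Rightarrow> 1 | Tree t \<Rightarrow> 0)"

fun wtree_S :: "wtree \<Rightarrow> 'k::field TT" where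
  "wtree_S (Leaf a) = - gen (Tree (Leaf a))"
| "wtree_S (Graft s t) = T_vee (wtree_S t) (wtree_S s)"

definition T_S :: "'k::field TT \<Rightarrow> 'k TT"
  where "T_S = lin_ext pscale (\<lambda>b. case b of One \<Rightarrow> gen One | Tree t \<Rightarrow> wtree_S t)"

section \<open>The free Hom-associative algebra with 1-generator\<close>

definition T_ideal :: "'k::field TT set \<Rightarrow> bool"
  where "T_ideal N \<longleftrightarrow> module.subspace pscale N \<and> (\<forall>x. \<forall>n\<in>N. T_vee x n \<in> N \<and> T_vee n x \<in> N)"

definition hom_assoc_ideal :: "'k::field TT set"
  where "hom_assoc_ideal = T_ideal hull
    {T_vee (T_vee (gen p) (gen q)) (T_alpha (gen r)) - T_vee (T_alpha (gen p)) (T_vee (gen q) (gen r)) |p q r. True}"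

lemma lin_ext_add: "lin_ext pscale f (u + v) = lin_ext pscale f u + lin_ext pscale f v"
  using linear_lin_ext[OF vector_space_pscale] unfolding Vector_Spaces.linear_iff by blast

lemma lin_ext_scale: "lin_ext pscale f (pscale c u) = pscale c (lin_ext pscale f u)"
  using linear_lin_ext[OF vector_space_pscale] unfolding Vector_Spaces.linear_iff by blast

lemma lin_ext_pm_gen [simp]: "lin_ext pscale f (gen x) = f x"
  by (rule lin_ext_gen[OF vector_space_pscale])

lemma lin_ext_param:
  assumes "vector_space s1" "\<And>x. Vector_Spaces.linear s1 pscale (\<lambda>y. f y x)"
  shows "Vector_Spaces.linear s1 pscale (\<lambda>y. lin_ext pscale (f y) u)"
  using assms unfolding Vector_Spaces.linear_iff lin_ext_def
  by (auto simp: pm.scale_right_distrib sum.distrib pm.scale_sum_right mult.commute)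

lemma linear_comp2:
  assumes "Vector_Spaces.linear s1 s2 f" "Vector_Spaces.linear s2 s3 g"
  shows "Vector_Spaces.linear s1 s3 (\<lambda>x. g (f x))"
  using Vector_Spaces.linear_compose[OF assms] by (simp add: o_def)

lemma linear_sub:
  assumes "Vector_Spaces.linear s1 s2 f" "Vector_Spaces.linear s1 s2 g"
  shows "Vector_Spaces.linear s1 s2 (\<lambda>x. f x - g x)"
proof -
  interpret f: Vector_Spaces.linear s1 s2 f by fact
  interpret g: Vector_Spaces.linear s1 s2 g by fact
  show ?thesis unfolding Vector_Spaces.linear_iff
    by (intro conjI f.vs1.vector_space_axioms f.vs2.vector_space_axioms)
       (simp_all add: f.add g.add f.scale g.scale f.vs2.scale_right_diff_distrib)
qed

lemma linear_T_alpha: "Vector_Spaces.linear pscale pscale T_alpha"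
  unfolding T_alpha_def by (rule linear_lin_ext[OF vector_space_pscale])

lemma linear_T_vee1: "Vector_Spaces.linear pscale pscale (\<lambda>x. T_vee x y)"
  unfolding T_vee_def by (rule linear_lin_ext[OF vector_space_pscale])

lemma linear_T_vee2: "Vector_Spaces.linear pscale pscale (T_vee x)"
  unfolding T_vee_def
  by (rule lin_ext_param[OF vector_space_pscale], rule linear_lin_ext[OF vector_space_pscale])

lemma linear_T_S: "Vector_Spaces.linear pscale pscale T_S"
  unfolding T_S_def by (rule linear_lin_ext[OF vector_space_pscale])

lemma vector_space_mult: "vector_space ((*) :: 'k::field \<Rightarrow> _)"
  by unfold_locales (auto simp: algebra_simps)

lemma linear_T_eps: "Vector_Spaces.linear pscale (*) T_eps"
  unfolding T_eps_def by (rule linear_lin_ext[OF vector_space_mult])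

lemma linearD:
  assumes "Vector_Spaces.linear s1 s2 f"
  shows "f (x + y) = f x + f y" "f (x - y) = f x - f y" "f (s1 c x) = s2 c (f x)" "f (- x) = - f x" "f 0 = 0"
proof -
  interpret Vector_Spaces.linear s1 s2 f by fact
  show "f (x + y) = f x + f y" "f (x - y) = f x - f y" "f (s1 c x) = s2 c (f x)" "f (- x) = - f x" "f 0 = 0"
    by (auto simp: add diff scale neg zero)
qed

lemmas T_alpha_simps = linearD[OF linear_T_alpha]
lemmas T_S_simps = linearD[OF linear_T_S]
lemmas T_eps_simps = linearD[OF linear_T_eps]
lemmas T_vee_simps1 = linearD[OF linear_T_vee1]
lemmas T_vee_simps2 = linearD[OF linear_T_vee2]

lemma T_vee_gen [simp]: "T_vee (gen b) (gen c) = gen (basis_vee b c)"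
  by (simp add: T_vee_def)

lemma T_alpha_gen [simp]: "T_alpha (gen b) = gen (basis_alpha b)"
  by (simp add: T_alpha_def)

lemma T_S_gen_One [simp]: "T_S (gen One) = gen One"
  by (simp add: T_S_def)

lemma T_S_gen_Tree [simp]: "T_S (gen (Tree t)) = wtree_S t"
  by (simp add: T_S_def)

lemma T_eps_gen [simp]: "T_eps (gen b) = (case b of One \<Rightarrow> 1 | Tree t \<Rightarrow> 0)"
  by (simp add: T_eps_def lin_ext_gen[OF vector_space_mult])

lemma basis_vee_One [simp]: "basis_vee b One = basis_alpha b"
  by (cases b) auto

lemma basis_alpha_vee: "basis_alpha (basis_vee b c) = basis_vee (basis_alpha b) (basis_alpha c)"
  by (cases b; cases c) auto

lemma T_alpha_vee: "T_alpha (T_vee x y) = T_vee (T_alpha x) (T_alpha y)"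
proof (rule linear_gen_eqI[of pscale _ _ x])
  show "T_alpha (T_vee (gen b) y) = T_vee (T_alpha (gen b)) (T_alpha y)" for b
  proof (rule linear_gen_eqI[of pscale _ _ y])
    show "T_alpha (T_vee (gen b) (gen c)) = T_vee (T_alpha (gen b)) (T_alpha (gen c))" for c
      by (simp add: basis_alpha_vee)
  qed (rule linear_comp2[OF linear_T_vee2 linear_T_alpha] linear_comp2[OF linear_T_alpha linear_T_vee2])+
qed (rule linear_comp2[OF linear_T_vee1 linear_T_alpha] linear_comp2[OF linear_T_alpha linear_T_vee1])+

lemma T_vee_One_left: "T_vee (gen One) x = T_alpha x"
proof (rule linear_gen_eqI[of pscale _ _ x])
  show "T_vee (gen One) (gen b) = T_alpha (gen b)" for b by simp
qed (rule linear_T_vee2 linear_T_alpha)+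

lemma T_vee_One_right: "T_vee x (gen One) = T_alpha x"
proof (rule linear_gen_eqI[of pscale _ _ x])
  show "T_vee (gen b) (gen One) = T_alpha (gen b)" for b by simp
qed (rule linear_T_vee1 linear_T_alpha)+

lemma wtree_S_alpha: "wtree_S (wtree_alpha t) = T_alpha (wtree_S t)"
  by (induction t) (auto simp: T_alpha_vee T_alpha_simps)

lemma T_S_vee: "T_S (T_vee x y) = T_vee (T_S y) (T_S x)"
proof (rule linear_gen_eqI[of pscale _ _ x])
  show "T_S (T_vee (gen b) y) = T_vee (T_S y) (T_S (gen b))" for b
  proof (rule linear_gen_eqI[of pscale _ _ y])
    show "T_S (T_vee (gen b) (gen c)) = T_vee (T_S (gen c)) (T_S (gen b))" for c
      by (cases b; cases c) (simp_all add: T_vee_One_left T_vee_One_right wtree_S_alpha)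
  qed (rule linear_comp2[OF linear_T_vee2 linear_T_S] linear_comp2[OF linear_T_S linear_T_vee1])+
qed (rule linear_comp2[OF linear_T_vee1 linear_T_S] linear_comp2[OF linear_T_S linear_T_vee2])+

lemma T_S_alpha: "T_S (T_alpha x) = T_alpha (T_S x)"
  using T_S_vee[of "gen One" x] by (simp add: T_vee_One_left T_vee_One_right)

lemma T_eps_vee: "T_eps (T_vee x y) = T_eps x * T_eps y"
proof (rule linear_gen_eqI[of "(*)" _ _ x])
  have l: "Vector_Spaces.linear (*) (*) (\<lambda>a. a * c)" "Vector_Spaces.linear (*) (*) (\<lambda>a. c * a)" for c :: 'a
    unfolding Vector_Spaces.linear_iff using vector_space_mult by (auto simp: algebra_simps)
  show "Vector_Spaces.linear pscale (*) (\<lambda>x. T_eps x * T_eps y)"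
    by (rule linear_comp2[OF linear_T_eps l(1)])
  show "T_eps (T_vee (gen b) y) = T_eps (gen b) * T_eps y" for b
  proof (rule linear_gen_eqI[of "(*)" _ _ y])
    show "T_eps (T_vee (gen b) (gen c)) = T_eps (gen b) * (T_eps (gen c) :: 'a)" for c
      by (cases b; cases c) simp_all
    show "Vector_Spaces.linear pscale (*) (\<lambda>x :: 'a TT. T_eps (gen b) * T_eps x)"
      by (rule linear_comp2[where g = "\<lambda>a. T_eps (gen b) * a", OF linear_T_eps l(2)])
  qed (rule linear_comp2[OF linear_T_vee2 linear_T_eps])+
qed (rule linear_comp2[OF linear_T_vee1 linear_T_eps])+

lemma T_eps_alpha: "T_eps (T_alpha x) = T_eps x"
  using T_eps_vee[of "gen One" x] by (simp add: T_vee_One_left)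

lemma T_ideal_hom_assoc_ideal: "T_ideal hom_assoc_ideal"
  unfolding hom_assoc_ideal_def
proof (rule hull_in)
  fix \<T> :: "'a TT set set"
  assume *: "Ball \<T> T_ideal"
  have "module.subspace pscale (\<Inter>\<T>)"
    by (rule pm.subspace_Inter) (use * in \<open>auto simp: T_ideal_def\<close>)
  with * show "T_ideal (\<Inter>\<T>)" by (auto simp: T_ideal_def)
qed

lemma subspace_hom_assoc_ideal: "module.subspace pscale hom_assoc_ideal"
  by (rule T_ideal_hom_assoc_ideal[unfolded T_ideal_def, THEN conjunct1])

lemma hom_assoc_ideal_vee:
  "n \<in> hom_assoc_ideal \<Longrightarrow> T_vee x n \<in> hom_assoc_ideal"
  "n \<in> hom_assoc_ideal \<Longrightarrow> T_vee n x \<in> hom_assoc_ideal"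
  using T_ideal_hom_assoc_ideal by (auto simp: T_ideal_def)

lemma hom_assoc_ideal_minimal:
  assumes "T_ideal N"
    and "\<And>p q r. T_vee (T_vee (gen p) (gen q)) (T_alpha (gen r)) - T_vee (T_alpha (gen p)) (T_vee (gen q) (gen r)) \<in> N"
    and "x \<in> hom_assoc_ideal"
  shows "x \<in> N"
proof -
  have "hom_assoc_ideal \<subseteq> N" unfolding hom_assoc_ideal_def
    by (rule hull_minimal) (use assms in auto)
  with assms(3) show ?thesis by blast
qed

lemma hom_assoc_ideal_assoc:
  "T_vee (T_vee x y) (T_alpha z) - T_vee (T_alpha x) (T_vee y z) \<in> hom_assoc_ideal"
proof (rule linear_gen_subspaceI[OF _ subspace_hom_assoc_ideal, of _ x])
  fix p
  show "T_vee (T_vee (gen p) y) (T_alpha z) - T_vee (T_alpha (gen p)) (T_vee y z) \<in> hom_assoc_ideal"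
  proof (rule linear_gen_subspaceI[OF _ subspace_hom_assoc_ideal, of _ y])
    fix q
    show "T_vee (T_vee (gen p) (gen q)) (T_alpha z) - T_vee (T_alpha (gen p)) (T_vee (gen q) z) \<in> hom_assoc_ideal"
    proof (rule linear_gen_subspaceI[OF _ subspace_hom_assoc_ideal, of _ z])
      fix r
      show "T_vee (T_vee (gen p) (gen q)) (T_alpha (gen r)) - T_vee (T_alpha (gen p)) (T_vee (gen q) (gen r)) \<in> hom_assoc_ideal"
        unfolding hom_assoc_ideal_def by (rule hull_inc) blast
    qed (intro linear_sub linear_comp2[OF linear_T_vee2 linear_T_vee2] linear_comp2[OF linear_T_alpha linear_T_vee2])
  qed (intro linear_sub linear_comp2[OF linear_T_vee2 linear_T_vee1] linear_comp2[OF linear_T_vee1 linear_T_vee2])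
qed (intro linear_sub linear_comp2[OF linear_T_vee1 linear_T_vee1] linear_comp2[OF linear_T_alpha linear_T_vee1])

lemma subspace_vimage:
  assumes "Vector_Spaces.linear pscale s f" "module.subspace s N"
  shows "module.subspace pscale {x. f x \<in> N}"
proof -
  interpret Vector_Spaces.linear pscale s f by fact
  show ?thesis
    by (rule pm.subspaceI)
       (use assms(2) in \<open>auto simp: add scale zero vs2.subspace_0 vs2.subspace_add vs2.subspace_scale\<close>)
qed

lemma hom_assoc_ideal_alpha: "x \<in> hom_assoc_ideal \<Longrightarrow> T_alpha x \<in> hom_assoc_ideal"
  using hom_assoc_ideal_vee(2)[of x "gen One"] by (simp add: T_vee_One_right)

lemma hom_assoc_ideal_S: "x \<in> hom_assoc_ideal \<Longrightarrow> T_S x \<in> hom_assoc_ideal"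
proof -
  assume x: "x \<in> hom_assoc_ideal"
  have "x \<in> {x. T_S x \<in> hom_assoc_ideal}"
  proof (rule hom_assoc_ideal_minimal[OF _ _ x])
    show "T_ideal {x. T_S x \<in> hom_assoc_ideal}"
      unfolding T_ideal_def
      using subspace_vimage[OF linear_T_S subspace_hom_assoc_ideal]
      by (auto simp: T_S_vee hom_assoc_ideal_vee)
    fix p q r :: basis
    let ?p = "T_S (gen p) :: 'a TT" and ?q = "T_S (gen q) :: 'a TT" and ?r = "T_S (gen r) :: 'a TT"
    have "- (T_vee (T_vee ?r ?q) (T_alpha ?p) - T_vee (T_alpha ?r) (T_vee ?q ?p)) \<in> hom_assoc_ideal"
      by (intro pm.subspace_neg subspace_hom_assoc_ideal hom_assoc_ideal_assoc)
    then show "T_vee (T_vee (gen p) (gen q)) (T_alpha (gen r)) - T_vee (T_alpha (gen p)) (T_vee (gen q) (gen r))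
        \<in> {x :: 'a TT. T_S x \<in> hom_assoc_ideal}"
      by (simp del: T_vee_gen T_alpha_gen T_S_gen_One T_S_gen_Tree add: T_S_simps T_S_vee T_S_alpha)
  qed
  then show ?thesis by simp
qed

lemma hom_assoc_ideal_eps: "x \<in> hom_assoc_ideal \<Longrightarrow> T_eps x = 0"
proof -
  assume x: "x \<in> hom_assoc_ideal"
  interpret m: vector_space "(*) :: 'a \<Rightarrow> 'a \<Rightarrow> 'a" by (rule vector_space_mult)
  have "x \<in> {x. T_eps x \<in> {0}}"
  proof (rule hom_assoc_ideal_minimal[OF _ _ x])
    show "T_ideal {x :: 'a TT. T_eps x \<in> {0}}"
      unfolding T_ideal_def
      using subspace_vimage[OF linear_T_eps m.subspace_single_0]
      by (auto simp: T_eps_vee)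
    fix p q r :: basis
    show "T_vee (T_vee (gen p) (gen q)) (T_alpha (gen r)) - T_vee (T_alpha (gen p)) (T_vee (gen q) (gen r))
        \<in> {x :: 'a TT. T_eps x \<in> {0}}"
      by (simp del: T_vee_gen T_alpha_gen T_eps_gen add: T_eps_simps T_eps_vee T_eps_alpha)
  qed
  then show ?thesis by simp
qed

quotient_type (overloaded) 'k TI = "'k::field TT" / "\<lambda>x y. x - y \<in> hom_assoc_ideal" morphisms rep_TI abs_TI
proof (rule equivpI)
  note s = subspace_hom_assoc_ideal
  show "reflp (\<lambda>x y :: 'k TT. x - y \<in> hom_assoc_ideal)"
    using pm.subspace_0[OF s] by (auto intro: reflpI)
  show "symp (\<lambda>x y :: 'k TT. x - y \<in> hom_assoc_ideal)"
  proof (rule sympI)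
    fix x y :: "'k TT" assume "x - y \<in> hom_assoc_ideal"
    from pm.subspace_neg[OF s this] show "y - x \<in> hom_assoc_ideal" by simp
  qed
  show "transp (\<lambda>x y :: 'k TT. x - y \<in> hom_assoc_ideal)"
  proof (rule transpI)
    fix x y z :: "'k TT" assume "x - y \<in> hom_assoc_ideal" "y - z \<in> hom_assoc_ideal"
    from pm.subspace_add[OF s this] show "x - z \<in> hom_assoc_ideal" by simp
  qed
qed

instantiation TI :: (field) ab_group_add
begin

lift_definition zero_TI :: "'a TI" is 0 .
lift_definition plus_TI :: "'a TI \<Rightarrow> 'a TI \<Rightarrow> 'a TI" is "(+)"
  by (drule (1) pm.subspace_add[OF subspace_hom_assoc_ideal]) (simp add: algebra_simps)
lift_definition minus_TI :: "'a TI \<Rightarrow> 'a TI \<Rightarrow> 'a TI" is "(-)"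
  by (drule (1) pm.subspace_diff[OF subspace_hom_assoc_ideal]) (simp add: algebra_simps)
lift_definition uminus_TI :: "'a TI \<Rightarrow> 'a TI" is uminus
  by (drule pm.subspace_neg[OF subspace_hom_assoc_ideal]) (simp add: algebra_simps)

instance
  by standard (transfer; use pm.subspace_0[OF subspace_hom_assoc_ideal] in \<open>simp add: algebra_simps\<close>)+

end

lift_definition TI_scale :: "'k::field \<Rightarrow> 'k TI \<Rightarrow> 'k TI" is pscale
  by (drule pm.subspace_scale[OF subspace_hom_assoc_ideal]) (simp add: pm.scale_right_diff_distrib)

lift_definition TI_one :: "'k::field TI" is "gen One" .

lift_definition TI_alpha :: "'k::field TI \<Rightarrow> 'k TI" is T_alpha
  by (drule hom_assoc_ideal_alpha) (simp add: T_alpha_simps)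

lift_definition TI_vee :: "'k::field TI \<Rightarrow> 'k TI \<Rightarrow> 'k TI" is T_vee
proof -
  fix x x' y y' :: "'k TT"
  assume "x - x' \<in> hom_assoc_ideal" "y - y' \<in> hom_assoc_ideal"
  then have "T_vee (x - x') y + T_vee x' (y - y') \<in> hom_assoc_ideal"
    by (intro pm.subspace_add[OF subspace_hom_assoc_ideal] hom_assoc_ideal_vee)
  then show "T_vee x y - T_vee x' y' \<in> hom_assoc_ideal"
    by (simp add: T_vee_simps1 T_vee_simps2)
qed

definition TI_unit :: "'k::field \<Rightarrow> 'k TI"
  where "TI_unit c = TI_scale c TI_one"

lift_definition TI_eps :: "'k::field TI \<Rightarrow> 'k" is T_eps
  by (drule hom_assoc_ideal_eps) (simp add: T_eps_simps)

lift_definition TI_S :: "'k::field TI \<Rightarrow> 'k TI" is T_S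
  by (drule hom_assoc_ideal_S) (simp add: T_S_simps)

text \<open>The map induced by \<open>(\<pi> \<otimes> \<pi>) \<circ> \<Delta>\<close>, where \<open>\<pi>\<close> is the quotient map.\<close>

definition TI_Delta :: "'k::field TI \<Rightarrow> (('k TI \<times> 'k TI) \<Rightarrow>\<^sub>0 'k) set"
  where "TI_Delta q = tensor_map TI_scale abs_TI abs_TI (T_Delta (rep_TI q))"

text \<open>The coproduct descends to the quotient, so that \<^const>\<open>TI_Delta\<close> does not depend on the choice of
  representatives: this is \<open>TI_Delta_abs\<close> below.\<close>

lemma vector_space_TI_scale: "vector_space (TI_scale :: 'k::field \<Rightarrow> 'k TI \<Rightarrow> _)"
  by unfold_locales
    (transfer; use pm.subspace_0[OF subspace_hom_assoc_ideal] in
      \<open>simp add: pm.scale_right_distrib pm.scale_left_distrib\<close>)+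

lemma linear_abs_TI: "Vector_Spaces.linear pscale TI_scale abs_TI"
  unfolding Vector_Spaces.linear_iff
  by (simp add: vector_space_pscale vector_space_TI_scale plus_TI.abs_eq TI_scale.abs_eq)

lemma linear_TI_vee1: "Vector_Spaces.linear TI_scale TI_scale (\<lambda>x. TI_vee x y)"
  unfolding Vector_Spaces.linear_iff
  by (intro conjI vector_space_TI_scale allI; transfer)
    (simp_all add: T_vee_simps1 pm.subspace_0[OF subspace_hom_assoc_ideal])

lemma linear_TI_vee2: "Vector_Spaces.linear TI_scale TI_scale (TI_vee x)"
  unfolding Vector_Spaces.linear_iff
  by (intro conjI vector_space_TI_scale allI; transfer)
    (simp_all add: T_vee_simps2 pm.subspace_0[OF subspace_hom_assoc_ideal])

lemma subspace_tensor_rel: "module.subspace pscale (tensor_rel s)"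
  unfolding tensor_rel_def by (rule pm.subspace_span)

lemma rep_coset: "rep (coset (tensor_rel s) u) - u \<in> tensor_rel s"
proof -
  have "rep (coset (tensor_rel s) u) \<in> coset (tensor_rel s) u"
    unfolding rep_def
    by (rule someI[of _ u]) (simp add: coset_def pm.subspace_0[OF subspace_tensor_rel])
  then show ?thesis by (simp add: coset_def)
qed

lemma coset_eqI:
  assumes "u - v \<in> tensor_rel s"
  shows "coset (tensor_rel s) u = coset (tensor_rel s) v"
proof -
  have "w - u \<in> tensor_rel s \<longleftrightarrow> w - v \<in> tensor_rel s" for w
    using pm.subspace_add[OF subspace_tensor_rel _ assms, of "w - u"]
      pm.subspace_diff[OF subspace_tensor_rel _ assms, of "w - v"] by auto
  then show ?thesis by (auto simp: coset_def)
qed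

lemma span_into:
  assumes "Vector_Spaces.linear pscale s f" "module.subspace s N" "\<And>u. u \<in> G \<Longrightarrow> f u \<in> N"
    and "u \<in> module.span pscale G"
  shows "f u \<in> N"
proof -
  have "module.span pscale G \<subseteq> {u. f u \<in> N}"
    by (rule pm.span_minimal) (use assms subspace_vimage in auto)
  with assms(4) show ?thesis by blast
qed

lemma slot_rel_map:
  assumes "Vector_Spaces.linear s1 s2 g" "u \<in> slot_rel s1 f" "Vector_Spaces.linear pscale pscale F"
    and "\<And>x. F (gen (f x)) = gen (h (g x))"
  shows "F u \<in> slot_rel s2 h"
proof -
  note simps = linearD[OF assms(3)] assms(4) linearD[OF assms(1)]
  from assms(2) consider x y where "u = gen (f (x + y)) - gen (f x) - gen (f y)"
    | c x where "u = gen (f (s1 c x)) - pscale c (gen (f x))"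
    unfolding slot_rel_def by blast
  then show ?thesis
  proof cases
    case 1
    then have "F u = gen (h (g x + g y)) - gen (h (g x)) - gen (h (g y))" by (simp only: simps)
    then show ?thesis unfolding slot_rel_def by blast
  next
    case 2
    then have "F u = gen (h (s2 c (g x))) - pscale c (gen (h (g x)))" by (simp only: simps)
    then show ?thesis unfolding slot_rel_def by blast
  qed
qed

lemma slot_rel_tensor1: "u \<in> slot_rel s (\<lambda>x. (x, y)) \<Longrightarrow> u \<in> tensor_rel s"
  unfolding tensor_rel_def by (rule pm.span_base) blast

lemma slot_rel_tensor2: "u \<in> slot_rel s (\<lambda>x. (y, x)) \<Longrightarrow> u \<in> tensor_rel s"
  unfolding tensor_rel_def by (rule pm.span_base) blast

lemma tensor_rel_map:
  assumes "Vector_Spaces.linear s1 s2 f" "Vector_Spaces.linear s1 s2 g" "u \<in> tensor_rel s1"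
  shows "lin_ext pscale (\<lambda>(x, y). gen (f x, g y)) u \<in> tensor_rel s2"
proof (rule span_into[OF linear_lin_ext[OF vector_space_pscale] subspace_tensor_rel _ assms(3)[unfolded tensor_rel_def]])
  fix v assume "v \<in> (\<Union>y. slot_rel s1 (\<lambda>x. (x, y))) \<union> (\<Union>x. slot_rel s1 (Pair x))"
  then consider y where "v \<in> slot_rel s1 (\<lambda>x. (x, y))" | x where "v \<in> slot_rel s1 (Pair x)" by blast
  then show "lin_ext pscale (\<lambda>(x, y). gen (f x, g y)) v \<in> tensor_rel s2"
  proof cases
    case 1
    have "lin_ext pscale (\<lambda>(x, y). gen (f x, g y)) v \<in> slot_rel s2 (\<lambda>x. (x, g y))"
      by (rule slot_rel_map[OF assms(1) 1 linear_lin_ext[OF vector_space_pscale]]) simp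
    then show ?thesis by (rule slot_rel_tensor1)
  next
    case 2
    have "lin_ext pscale (\<lambda>(x, y). gen (f x, g y)) v \<in> slot_rel s2 (\<lambda>y. (f x, y))"
      by (rule slot_rel_map[OF assms(2) 2 linear_lin_ext[OF vector_space_pscale]]) simp
    then show ?thesis by (rule slot_rel_tensor2)
  qed
qed

lemma tensor_map_coset:
  assumes "Vector_Spaces.linear s1 s2 f" "Vector_Spaces.linear s1 s2 g"
  shows "tensor_map s2 f g (coset (tensor_rel s1) u)
    = coset (tensor_rel s2) (lin_ext pscale (\<lambda>(x, y). gen (f x, g y)) u)"
  unfolding tensor_map_def
  by (rule coset_eqI)
    (use tensor_rel_map[OF assms rep_coset] in \<open>simp add: linearD[OF linear_lin_ext[OF vector_space_pscale]]\<close>)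

lemma comp_mult_gen [simp]: "comp_mult m (gen (x, y)) (gen (x', y')) = gen (m x x', m y y')"
  by (simp add: comp_mult_def)

lemma linear_comp_mult1: "Vector_Spaces.linear pscale pscale (\<lambda>u. comp_mult m u v)"
  unfolding comp_mult_def by (rule linear_lin_ext[OF vector_space_pscale])

lemma linear_comp_mult2: "Vector_Spaces.linear pscale pscale (comp_mult m u)"
proof -
  have "Vector_Spaces.linear pscale pscale
      (\<lambda>v. (\<lambda>(x, y). lin_ext pscale (\<lambda>(x', y'). gen (m x x', m y y')) v) p)" for p
    by (cases p) (simp add: linear_lin_ext[OF vector_space_pscale])
  then show ?thesis
    unfolding comp_mult_def by (rule lin_ext_param[OF vector_space_pscale])
qed

lemma tensor_rel_comp_mult1:
  assumes "\<And>y. Vector_Spaces.linear s s (\<lambda>x. m x y)" "u \<in> tensor_rel s"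
  shows "comp_mult m u v \<in> tensor_rel s"
proof (rule linear_gen_subspaceI[OF linear_comp_mult2 subspace_tensor_rel])
  fix p
  have "lin_ext pscale (\<lambda>(x, y). gen (m x (fst p), m y (snd p))) u \<in> tensor_rel s"
    by (rule tensor_rel_map[OF assms(1) assms(1) assms(2)])
  then show "comp_mult m u (gen p) \<in> tensor_rel s"
    by (cases p) (simp add: comp_mult_def)
qed

lemma tensor_rel_comp_mult2:
  assumes "\<And>x. Vector_Spaces.linear s s (m x)" "v \<in> tensor_rel s"
  shows "comp_mult m u v \<in> tensor_rel s"
proof (rule linear_gen_subspaceI[OF linear_comp_mult1 subspace_tensor_rel])
  fix p
  have "lin_ext pscale (\<lambda>(x, y). gen (m (fst p) x, m (snd p) y)) v \<in> tensor_rel s"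
    by (rule tensor_rel_map[OF assms(1) assms(1) assms(2)])
  then show "comp_mult m (gen p) v \<in> tensor_rel s"
    by (cases p) (simp add: comp_mult_def)
qed

lemma leaves_alpha [simp]: "leaves (wtree_alpha t) = leaves t"
  by (induction t) auto

lemma restr_alpha: "restr (wtree_alpha t) I = basis_alpha (restr t I)"
  by (induction t arbitrary: I) (auto simp: basis_alpha_vee)

text \<open>A representative of the class of \<open>(\<pi> \<otimes> \<pi>) (\<Delta> x)\<close>, where \<open>\<pi>\<close> is the quotient map.\<close>

definition proj_Delta :: "'k::field TT \<Rightarrow> ('k TI \<times> 'k TI) \<Rightarrow>\<^sub>0 'k"
  where "proj_Delta x = lin_ext pscale (\<lambda>(x, y). gen (abs_TI x, abs_TI y)) (lin_ext pscale basis_Delta x)"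

lemma linear_proj_Delta: "Vector_Spaces.linear pscale pscale proj_Delta"
  unfolding proj_Delta_def
  by (rule linear_comp2[OF linear_lin_ext[OF vector_space_pscale] linear_lin_ext[OF vector_space_pscale]])

lemma proj_Delta_One: "proj_Delta (gen One) = gen (abs_TI (gen One), abs_TI (gen One))"
  by (simp add: proj_Delta_def)

abbreviation splits :: "nat \<Rightarrow> (nat set \<times> nat set) set"
  where "splits n \<equiv> {(I, J). I \<union> J = {1..n} \<and> I \<inter> J = {}}"

lemma finite_splits: "finite (splits n)"
  by (rule finite_subset[of _ "Pow {1..n} \<times> Pow {1..n}"]) auto

lemma linear_sum_map:
  assumes "Vector_Spaces.linear s1 s2 f"
  shows "f (sum g A) = (\<Sum>x\<in>A. f (g x))"
proof -
  interpret Vector_Spaces.linear s1 s2 f by fact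
  show ?thesis by (rule sum)
qed

lemma proj_Delta_Tree:
  "proj_Delta (gen (Tree t)) = (\<Sum>(I, J)\<in>splits (leaves t).
    gen (abs_TI (gen (restr t I)), abs_TI (gen (restr t J))))"
  unfolding proj_Delta_def
  by (simp add: linear_sum_map[OF linear_lin_ext[OF vector_space_pscale]] split_def)

lemma abs_TI_basis_vee:
  "TI_vee (abs_TI (gen b)) (abs_TI (gen c)) = abs_TI (gen (basis_vee b c))"
  by (simp add: TI_vee.abs_eq)

lemma splits_bij:
  "bij_betw (\<lambda>((I1, J1), (I2, J2)). (I1 \<union> (+) m ` I2, J1 \<union> (+) m ` J2))
    (splits m \<times> splits n) (splits (m + n))"
proof (rule bij_betw_byWitness[where f' =
    "\<lambda>(I, J). ((I \<inter> {1..m}, J \<inter> {1..m}), ({i\<in>{1..n}. m + i \<in> I}, {i\<in>{1..n}. m + i \<in> J}))"])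
  have sub: "(I1 \<union> (+) m ` I2) \<inter> {1..m} = I1"
    "{i\<in>{1..n}. m + i \<in> I1 \<union> (+) m ` I2} = I2"
    if "I1 \<subseteq> {1..m}" "I2 \<subseteq> {1..n}" for I1 I2
    using that by fastforce+
  have im: "(+) m ` {1..n} = {m+1..m+n}"
    by simp
  show "\<forall>a\<in>splits m \<times> splits n.
      (\<lambda>(I, J). ((I \<inter> {1..m}, J \<inter> {1..m}), ({i\<in>{1..n}. m + i \<in> I}, {i\<in>{1..n}. m + i \<in> J})))
       ((\<lambda>((I1, J1), (I2, J2)). (I1 \<union> (+) m ` I2, J1 \<union> (+) m ` J2)) a) = a"
  proof
    fix a assume "a \<in> splits m \<times> splits n"
    then obtain I1 J1 I2 J2 where a: "a = ((I1, J1), (I2, J2))" and "I1 \<union> J1 = {1..m}" "I2 \<union> J2 = {1..n}"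
      by auto
    then have "I1 \<subseteq> {1..m}" "J1 \<subseteq> {1..m}" "I2 \<subseteq> {1..n}" "J2 \<subseteq> {1..n}" by auto
    then show "(\<lambda>(I, J). ((I \<inter> {1..m}, J \<inter> {1..m}), ({i\<in>{1..n}. m + i \<in> I}, {i\<in>{1..n}. m + i \<in> J})))
       ((\<lambda>((I1, J1), (I2, J2)). (I1 \<union> (+) m ` I2, J1 \<union> (+) m ` J2)) a) = a"
      by (simp only: a prod.case sub)
  qed
  have backward: "(I \<inter> {1..m}) \<union> (+) m ` {i\<in>{1..n}. m + i \<in> I} = I" if "I \<subseteq> {1..m+n}" for I
  proof (intro set_eqI iffI)
    fix i assume "i \<in> I"
    show "i \<in> I \<inter> {1..m} \<union> (+) m ` {i \<in> {1..n}. m + i \<in> I}"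
    proof (cases "i \<le> m")
      case True
      with \<open>i \<in> I\<close> that show ?thesis by auto
    next
      case False
      then have "i = m + (i - m)" by simp
      moreover have "i - m \<in> {i \<in> {1..n}. m + i \<in> I}" using \<open>i \<in> I\<close> that False by auto
      ultimately show ?thesis by blast
    qed
  qed auto
  show "\<forall>a\<in>splits (m + n).
      (\<lambda>((I1, J1), (I2, J2)). (I1 \<union> (+) m ` I2, J1 \<union> (+) m ` J2))
       ((\<lambda>(I, J). ((I \<inter> {1..m}, J \<inter> {1..m}), ({i\<in>{1..n}. m + i \<in> I}, {i\<in>{1..n}. m + i \<in> J}))) a) = a"
  proof
    fix a assume "a \<in> splits (m + n)"
    then obtain I J where a: "a = (I, J)" and "I \<union> J = {1..m+n}" by auto
    then have "I \<subseteq> {1..m+n}" "J \<subseteq> {1..m+n}" by auto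
    then show "(\<lambda>((I1, J1), (I2, J2)). (I1 \<union> (+) m ` I2, J1 \<union> (+) m ` J2))
       ((\<lambda>(I, J). ((I \<inter> {1..m}, J \<inter> {1..m}), ({i\<in>{1..n}. m + i \<in> I}, {i\<in>{1..n}. m + i \<in> J}))) a) = a"
      by (simp only: a prod.case backward)
  qed
  show "(\<lambda>(I, J). ((I \<inter> {1..m}, J \<inter> {1..m}), ({i\<in>{1..n}. m + i \<in> I}, {i\<in>{1..n}. m + i \<in> J})))
      ` splits (m + n) \<subseteq> splits m \<times> splits n"
  proof (rule image_subsetI)
    fix a assume "a \<in> splits (m + n)"
    then obtain I J where a: "a = (I, J)" and *: "I \<union> J = {1..m+n}" "I \<inter> J = {}" by auto
    have 1: "I \<inter> {1..m} \<union> J \<inter> {1..m} = {1..m}"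
      unfolding Int_Un_distrib2[symmetric] * by auto
    have "{i\<in>{1..n}. m + i \<in> I} \<union> {i\<in>{1..n}. m + i \<in> J} = {i\<in>{1..n}. m + i \<in> I \<union> J}" by auto
    also have "\<dots> = {1..n}" unfolding * by auto
    finally have 2: "{i\<in>{1..n}. m + i \<in> I} \<union> {i\<in>{1..n}. m + i \<in> J} = {1..n}" .
    have 3: "(I \<inter> {1..m}) \<inter> (J \<inter> {1..m}) = {}" "{i\<in>{1..n}. m + i \<in> I} \<inter> {i\<in>{1..n}. m + i \<in> J} = {}"
      using *(2) by auto
    show "(\<lambda>(I, J). ((I \<inter> {1..m}, J \<inter> {1..m}), ({i\<in>{1..n}. m + i \<in> I}, {i\<in>{1..n}. m + i \<in> J}))) a
        \<in> splits m \<times> splits n"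
      by (simp only: a prod.case mem_Sigma_iff mem_Collect_eq 1 2 3 simp_thms)
  qed
  show "(\<lambda>((I1, J1), (I2, J2)). (I1 \<union> (+) m ` I2, J1 \<union> (+) m ` J2)) ` (splits m \<times> splits n)
      \<subseteq> splits (m + n)"
  proof clarify
    fix I1 J1 I2 J2
    assume *: "I1 \<union> J1 = {1..m}" "I1 \<inter> J1 = {}" "I2 \<union> J2 = {1..n}" "I2 \<inter> J2 = {}"
    have "I1 \<union> (+) m ` I2 \<union> (J1 \<union> (+) m ` J2) = (I1 \<union> J1) \<union> (+) m ` (I2 \<union> J2)" by auto
    also have "\<dots> = {1..m+n}" unfolding * im by auto
    finally have 1: "I1 \<union> (+) m ` I2 \<union> (J1 \<union> (+) m ` J2) = {1..m+n}" .
    have sub1: "I1 \<subseteq> {1..m}" "J1 \<subseteq> {1..m}" "I2 \<subseteq> {1..n}" "J2 \<subseteq> {1..n}" using * by auto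
    have "I1 \<inter> (+) m ` J2 = {}" "(+) m ` I2 \<inter> J1 = {}" "(+) m ` I2 \<inter> (+) m ` J2 = (+) m ` (I2 \<inter> J2)"
      using sub1 by fastforce+
    then have "(I1 \<union> (+) m ` I2) \<inter> (J1 \<union> (+) m ` J2) = {}" using * by (simp add: Int_Un_distrib Int_Un_distrib2)
    with 1 show "I1 \<union> (+) m ` I2 \<union> (J1 \<union> (+) m ` J2) = {1..m+n} \<and>
        (I1 \<union> (+) m ` I2) \<inter> (J1 \<union> (+) m ` J2) = {}" by blast
  qed
qed

lemma restr_Graft_union:
  assumes "I1 \<subseteq> {1..leaves s}" "I2 \<subseteq> {1..leaves t}"
  shows "restr (Graft s t) (I1 \<union> (+) (leaves s) ` I2) = basis_vee (restr s I1) (restr t I2)"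
proof -
  have "(I1 \<union> (+) (leaves s) ` I2) \<inter> {1..leaves s} = I1"
    "{i\<in>{1..leaves t}. leaves s + i \<in> I1 \<union> (+) (leaves s) ` I2} = I2"
    using assms by fastforce+
  then show ?thesis by (simp del: Un_iff)
qed

lemma proj_Delta_basis_vee:
  "proj_Delta (gen (basis_vee b c)) = comp_mult TI_vee (proj_Delta (gen b)) (proj_Delta (gen c))"
proof -
  note sums = linear_sum_map[OF linear_comp_mult1] linear_sum_map[OF linear_comp_mult2]
  show ?thesis
  proof (cases b; cases c)
    fix s t assume bc: "b = Tree s" "c = Tree t"
    let ?g = "\<lambda>b c. gen (abs_TI (gen b), abs_TI (gen c)) :: ('a TI \<times> 'a TI) \<Rightarrow>\<^sub>0 'a"
    have "proj_Delta (gen (basis_vee b c)) = (\<Sum>(I, J)\<in>splits (leaves s + leaves t).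
        ?g (restr (Graft s t) I) (restr (Graft s t) J))"
      by (simp add: bc proj_Delta_Tree del: restr.simps)
    also have "\<dots> = (\<Sum>((I1, J1), (I2, J2))\<in>splits (leaves s) \<times> splits (leaves t).
        ?g (restr (Graft s t) (I1 \<union> (+) (leaves s) ` I2)) (restr (Graft s t) (J1 \<union> (+) (leaves s) ` J2)))"
      by (subst sum.reindex_bij_betw[OF splits_bij, symmetric]) (simp add: split_def)
    also have "\<dots> = (\<Sum>((I1, J1), (I2, J2))\<in>splits (leaves s) \<times> splits (leaves t).
        ?g (basis_vee (restr s I1) (restr t I2)) (basis_vee (restr s J1) (restr t J2)))"
    proof (rule sum.cong[OF refl], clarify)
      fix I1 J1 I2 J2
      assume *: "I1 \<union> J1 = {1..leaves s}" "I2 \<union> J2 = {1..leaves t}"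
      then have "I1 \<subseteq> {1..leaves s}" "J1 \<subseteq> {1..leaves s}" "I2 \<subseteq> {1..leaves t}" "J2 \<subseteq> {1..leaves t}"
        by auto
      then show "?g (restr (Graft s t) (I1 \<union> (+) (leaves s) ` I2)) (restr (Graft s t) (J1 \<union> (+) (leaves s) ` J2))
        = ?g (basis_vee (restr s I1) (restr t I2)) (basis_vee (restr s J1) (restr t J2))"
        by (simp only: restr_Graft_union)
    qed
    also have "\<dots> = (\<Sum>p\<in>splits (leaves s). \<Sum>q\<in>splits (leaves t).
        comp_mult TI_vee (?g (restr s (fst p)) (restr s (snd p))) (?g (restr t (fst q)) (restr t (snd q))))"
      by (simp add: abs_TI_basis_vee sum.cartesian_product split_def)
    also have "\<dots> = comp_mult TI_vee (proj_Delta (gen b)) (proj_Delta (gen c))"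
      unfolding bc proj_Delta_Tree split_def linear_sum_map[OF linear_comp_mult1]
      by (simp only: linear_sum_map[OF linear_comp_mult2])
    finally show ?thesis .
  qed (simp_all add: proj_Delta_One proj_Delta_Tree sums split_def restr_alpha abs_TI_basis_vee)
qed

lemma proj_Delta_vee: "proj_Delta (T_vee x y) = comp_mult TI_vee (proj_Delta x) (proj_Delta y)"
proof (rule linear_gen_eqI[of pscale _ _ x])
  show "proj_Delta (T_vee (gen b) y) = comp_mult TI_vee (proj_Delta (gen b)) (proj_Delta y)" for b
  proof (rule linear_gen_eqI[of pscale _ _ y])
    show "proj_Delta (T_vee (gen b) (gen c)) = comp_mult TI_vee (proj_Delta (gen b)) (proj_Delta (gen c))" for c
      by (simp add: proj_Delta_basis_vee)
  qed (rule linear_comp2[OF linear_T_vee2 linear_proj_Delta] linear_comp2[OF linear_proj_Delta linear_comp_mult2])+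
qed (rule linear_comp2[OF linear_T_vee1 linear_proj_Delta] linear_comp2[OF linear_proj_Delta linear_comp_mult1])+

lemma TI_hom_assoc: "TI_vee (TI_vee x y) (TI_vee TI_one z) = TI_vee (TI_vee TI_one x) (TI_vee y z)"
  by transfer (simp only: T_vee_One_left hom_assoc_ideal_assoc)

lemma comp_mult_hom_assoc:
  "comp_mult TI_vee (comp_mult TI_vee u v) (comp_mult TI_vee (gen (TI_one, TI_one)) w)
    = comp_mult TI_vee (comp_mult TI_vee (gen (TI_one, TI_one)) u) (comp_mult TI_vee v w)"
proof (rule linear_gen_eqI[of pscale _ _ u])
  let ?m = "comp_mult TI_vee"
  let ?o = "gen (TI_one, TI_one)"
  fix p
  show "?m (?m (gen p) v) (?m ?o w) = ?m (?m ?o (gen p)) (?m v w)"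
  proof (rule linear_gen_eqI[of pscale _ _ v])
    fix q
    show "?m (?m (gen p) (gen q)) (?m ?o w) = ?m (?m ?o (gen p)) (?m (gen q) w)"
    proof (rule linear_gen_eqI[of pscale _ _ w])
      fix r
      show "?m (?m (gen p) (gen q)) (?m ?o (gen r)) = ?m (?m ?o (gen p)) (?m (gen q) (gen r))"
        by (cases p; cases q; cases r) (simp add: TI_hom_assoc)
    qed (rule linear_comp2[OF linear_comp_mult2 linear_comp_mult2])+
  qed (rule linear_comp2[OF linear_comp_mult2 linear_comp_mult1] linear_comp2[OF linear_comp_mult1 linear_comp_mult2])+
qed (rule linear_comp2[OF linear_comp_mult1 linear_comp_mult1] linear_comp2[OF linear_comp_mult2 linear_comp_mult1])+

lemma hom_assoc_ideal_proj_Delta: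
  assumes "x \<in> hom_assoc_ideal"
  shows "proj_Delta x \<in> tensor_rel TI_scale"
proof -
  have "x \<in> {x. proj_Delta x \<in> tensor_rel TI_scale}"
  proof (rule hom_assoc_ideal_minimal[OF _ _ assms])
    show "T_ideal {x :: 'a TT. proj_Delta x \<in> tensor_rel TI_scale}"
      unfolding T_ideal_def
      using subspace_vimage[OF linear_proj_Delta subspace_tensor_rel]
      by (auto simp: proj_Delta_vee tensor_rel_comp_mult1[OF linear_TI_vee1] tensor_rel_comp_mult2[OF linear_TI_vee2])
    fix p q r
    have a: "proj_Delta (T_alpha x) = comp_mult TI_vee (gen (TI_one, TI_one)) (proj_Delta x)" for x :: "'a TT"
      using proj_Delta_vee[of "gen One" x]
      by (simp add: T_vee_One_left proj_Delta_One TI_one.abs_eq)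
    have "proj_Delta (T_vee (T_vee (gen p) (gen q)) (T_alpha (gen r)) - T_vee (T_alpha (gen p)) (T_vee (gen q) (gen r))) = (0 :: ('a TI \<times> 'a TI) \<Rightarrow>\<^sub>0 'a)"
      unfolding linearD[OF linear_proj_Delta] proj_Delta_vee a comp_mult_hom_assoc by simp
    then show "T_vee (T_vee (gen p) (gen q)) (T_alpha (gen r)) - T_vee (T_alpha (gen p)) (T_vee (gen q) (gen r))
        \<in> {x :: 'a TT. proj_Delta x \<in> tensor_rel TI_scale}"
      by (metis (mono_tags, lifting) mem_Collect_eq pm.subspace_0[OF subspace_tensor_rel])
  qed
  then show ?thesis by simp
qed

lemma TI_Delta_abs: "TI_Delta (abs_TI x) = tensor_map TI_scale abs_TI abs_TI (T_Delta x)"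
proof -
  have t: "tensor_map TI_scale abs_TI abs_TI (T_Delta y) = coset (tensor_rel TI_scale) (proj_Delta y)" for y :: "'a TT"
    unfolding T_Delta_def proj_Delta_def by (rule tensor_map_coset[OF linear_abs_TI linear_abs_TI])
  have "rep_TI (abs_TI x) - x \<in> hom_assoc_ideal"
    using Quotient3_abs_rep[OF Quotient3_TI, of "abs_TI x"] by (simp only: TI.abs_eq_iff)
  from hom_assoc_ideal_proj_Delta[OF this] show ?thesis
    unfolding TI_Delta_def t by (intro coset_eqI) (simp add: linearD[OF linear_proj_Delta])
qed

end

theory Submission
  imports Defs
begin

text \<open>The set \<open>B\<close> is generated by \<open>\<one>\<close> and the one-leaf trees under the product \<open>\<or>\<close>
  (\<open>basis_vee_induct\<close>). The axioms on the product hold by the choice of the ideal, and \<open>\<Delta>\<close>, \<open>\<epsilon>\<close> and \<open>S\<close> are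
  compatible with \<open>\<or>\<close>, where \<open>S\<close> reverses it. The coalgebra axioms and the antipode identities are
  preserved by products, so that they need only be checked on the generators.

  A coalgebra axiom is an equality of multiplicative maps. The coproduct is multiplicative, hence
  so are \<open>(id \<otimes> \<Delta>) \<circ> \<Delta>\<close> and \<open>(\<Delta> \<otimes> id) \<circ> \<Delta>\<close>, and likewise \<open>(id \<otimes> \<epsilon>) \<circ> \<Delta>\<close>, \<open>(\<epsilon> \<otimes> id) \<circ> \<Delta>\<close> and
  the identity. On a leaf \<open>x\<close> one has \<open>\<Delta> x = x \<otimes> \<one> + \<one> \<otimes> x\<close>, and both claims are immediate. Coassociativity
  already holds in the free space \<open>\<bbbT>\<close> (\<open>free_Delta_coassoc\<close>), where tensor powers have the tuples of
  basis elements as a basis; it is then carried to the quotient.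

  For the antipode, write \<open>\<Delta> x = \<Sum> x\<^sub>1 \<otimes> x\<^sub>2\<close>. As \<open>S\<close> reverses products, \<open>S \<star> id\<close> at a product is
  \<open>\<Sum> (S y\<^sub>1 \<or> S x\<^sub>1) \<or> (x\<^sub>2 \<or> y\<^sub>2)\<close>. Hom-associativity gives \<open>\<alpha> ((a \<or> b) \<or> (c \<or> d)) = (\<alpha> a \<or> (b \<or> c)) \<or> \<alpha>\<^sup>2 d\<close>
  (\<open>alpha_mul_mul\<close>), so that one application of \<open>\<alpha>\<close> brings \<open>S x\<^sub>1\<close> and \<open>x\<^sub>2\<close> together. If \<open>\<alpha>\<^sup>k\<close> turns
  \<open>\<Sum> S x\<^sub>1 \<or> x\<^sub>2\<close> into \<open>\<epsilon> x\<close> times \<open>\<one>\<close>, what remains is \<open>\<epsilon> x\<close> times the image of \<open>\<Sum> S y\<^sub>1 \<or> y\<^sub>2\<close> under a power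
  of \<open>\<alpha>\<close>. Hence the antipode identity for \<open>x\<close> and \<open>y\<close>, with exponents \<open>k\<close> and \<open>l\<close>, implies it for \<open>x \<or> y\<close>
  with exponent \<open>k + l + 1\<close> (\<open>nested_convolution\<close>, \<open>antipodal_at_mul\<close>). This holds in every Hom-bialgebra,
  for every linear \<open>S\<close> that reverses products.
  On \<open>\<one>\<close> and on leaves the identity holds with exponent \<open>0\<close>: \<open>S \<star> id\<close> maps a leaf \<open>x\<close> to
  \<open>- \<alpha> x + \<alpha> x\<close>, and \<open>id \<star> S\<close> maps it to \<open>\<alpha> x - \<alpha> x\<close>.\<close>

section \<open>Linear extensions\<close>

lemma linear_apply_lin_ext:
  assumes "Vector_Spaces.linear s1 s2 F"
  shows "F (lin_ext s1 h u) = lin_ext s2 (\<lambda>x. F (h x)) u"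
proof -
  interpret Vector_Spaces.linear s1 s2 F by fact
  show ?thesis unfolding lin_ext_def by (simp add: sum scale)
qed

lemma lin_ext_lin_ext:
  assumes "vector_space s"
  shows "lin_ext s h (lin_ext pscale g u) = lin_ext s (\<lambda>x. lin_ext s h (g x)) u"
  by (rule linear_apply_lin_ext[OF linear_lin_ext[OF assms]])

lemma lin_ext_swap:
  assumes "vector_space s"
  shows "lin_ext s (\<lambda>p. lin_ext s (\<lambda>q. h p q) v) u = lin_ext s (\<lambda>q. lin_ext s (\<lambda>p. h p q) u) v"
proof -
  interpret vector_space s by fact
  show ?thesis
    unfolding lin_ext_def scale_sum_right
    by (subst sum.swap) (simp add: mult.commute)
qed

lemma bilinear_gen_eqI:
  assumes "\<And>v. Vector_Spaces.linear pscale s (\<lambda>u. f u v)" "\<And>u. Vector_Spaces.linear pscale s (f u)"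
    and "\<And>v. Vector_Spaces.linear pscale s (\<lambda>u. g u v)" "\<And>u. Vector_Spaces.linear pscale s (g u)"
    and "\<And>x y. f (gen x) (gen y) = g (gen x) (gen y)"
  shows "f u v = g u v"
proof (rule linear_gen_eqI[OF assms(1) assms(3)])
  fix x
  show "f (gen x) v = g (gen x) v"
    by (rule linear_gen_eqI[OF assms(2) assms(4) assms(5)])
qed

lemma lin_ext_comp_mult:
  assumes "vector_space s"
  shows "lin_ext s h (comp_mult m u v)
    = lin_ext s (\<lambda>(x, y). lin_ext s (\<lambda>(x', y'). h (m x x', m y y')) v) u"
  unfolding comp_mult_def lin_ext_lin_ext[OF assms]
  by (simp add: split_def lin_ext_lin_ext[OF assms] lin_ext_gen[OF assms])

section \<open>Maps out of tensor products\<close>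

text \<open>It suffices that \<open>h\<close> is bilinear modulo a subspace \<open>N\<close>. For \<open>N = {0}\<close> this says that
  a bilinear map descends to the tensor square. A map such as \<open>id \<otimes> \<Delta>\<close>, defined through chosen representatives of the values of \<open>\<Delta>\<close>,
  is bilinear only modulo the relations of the third tensor power.\<close>

lemma lin_ext_tensor_rel_in:
  assumes N: "module.subspace s2 N" and s2: "vector_space s2"
    and add1: "\<And>x x' y. h (x + x') y - h x y - h x' y \<in> N"
    and scale1: "\<And>c x y. h (s c x) y - s2 c (h x y) \<in> N"
    and add2: "\<And>x y y'. h x (y + y') - h x y - h x y' \<in> N"
    and scale2: "\<And>c x y. h x (s c y) - s2 c (h x y) \<in> N"
    and u: "u \<in> tensor_rel s"
  shows "lin_ext s2 (\<lambda>(x, y). h x y) u \<in> N"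
proof (rule span_into[OF linear_lin_ext[OF s2] N _ u[unfolded tensor_rel_def]])
  note simps = linearD[OF linear_lin_ext[OF s2]] lin_ext_gen[OF s2]
  fix v assume "v \<in> (\<Union>y. slot_rel s (\<lambda>x. (x, y))) \<union> (\<Union>x. slot_rel s (Pair x))"
  then show "lin_ext s2 (\<lambda>(x, y). h x y) v \<in> N"
    unfolding slot_rel_def by (auto simp: simps add1 scale1 add2 scale2)
qed

lemma tensor_lift_coset:
  assumes "\<And>y. Vector_Spaces.linear s s2 (\<lambda>x. h x y)" "\<And>x. Vector_Spaces.linear s s2 (h x)"
  shows "tensor_lift s2 h (coset (tensor_rel s) u) = lin_ext s2 (\<lambda>(x, y). h x y) u"
proof -
  interpret s2: vector_space s2
    using assms(1) unfolding Vector_Spaces.linear_iff by blast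
  have "lin_ext s2 (\<lambda>(x, y). h x y) (rep (coset (tensor_rel s) u) - u) \<in> {0}"
    by (rule lin_ext_tensor_rel_in[OF s2.subspace_single_0 s2.vector_space_axioms _ _ _ _ rep_coset])
      (simp_all add: linearD[OF assms(1)] linearD[OF assms(2)])
  then show ?thesis
    by (simp add: tensor_lift_def linearD[OF linear_lin_ext[OF s2.vector_space_axioms]])
qed

lemma coset_rep:
  assumes "X \<in> tensor_space s"
  shows "coset (tensor_rel s) (rep X) = X"
  using assms coset_eqI[OF rep_coset] unfolding tensor_space_def by blast

lemma tensor_add_coset:
  "tensor_add s (coset (tensor_rel s) u) (coset (tensor_rel s) v) = coset (tensor_rel s) (u + v)"
  unfolding tensor_add_def
  by (rule coset_eqI)
    (use pm.subspace_add[OF subspace_tensor_rel rep_coset rep_coset, of s u v] in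
      \<open>simp add: algebra_simps\<close>)

lemma tensor_scale_coset:
  "tensor_scale s c (coset (tensor_rel s) u) = coset (tensor_rel s) (pscale c u)"
  unfolding tensor_scale_def
  by (rule coset_eqI)
    (use pm.subspace_scale[OF subspace_tensor_rel rep_coset, of c s u] in
      \<open>simp add: pm.scale_right_diff_distrib\<close>)

lemma tensor_mult_coset:
  assumes "\<And>y. Vector_Spaces.linear s s (\<lambda>x. m x y)" "\<And>x. Vector_Spaces.linear s s (m x)"
  shows "tensor_mult s m (coset (tensor_rel s) u) (coset (tensor_rel s) v)
    = coset (tensor_rel s) (comp_mult m u v)"
  unfolding tensor_mult_def
proof (rule coset_eqI)
  let ?u = "rep (coset (tensor_rel s) u)" and ?v = "rep (coset (tensor_rel s) v)"
  have "comp_mult m (?u - u) ?v + comp_mult m u (?v - v) \<in> tensor_rel s"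
    by (intro pm.subspace_add[OF subspace_tensor_rel] tensor_rel_comp_mult1 tensor_rel_comp_mult2
        assms rep_coset)
  then show "comp_mult m ?u ?v - comp_mult m u v \<in> tensor_rel s"
    by (simp add: linearD[OF linear_comp_mult1] linearD[OF linear_comp_mult2])
qed

section \<open>The antipode identities in products\<close>

context unital_hom_associative_algebra
begin

lemma linear_alpha_pow: "Vector_Spaces.linear scale scale (\<alpha> ^^ k)"
proof (induction k)
  case 0
  show ?case by (simp add: Vector_Spaces.linear_iff vector_space_axioms)
next
  case (Suc k)
  from Vector_Spaces.linear_compose[OF this linear_alpha] show ?case by (simp add: o_def)
qed

lemma alpha_pow_mul: "(\<alpha> ^^ k) (mul x y) = mul ((\<alpha> ^^ k) x) ((\<alpha> ^^ k) y)"
  by (induction k) (simp_all add: alpha_mul)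

lemma eta_eq: "\<eta> c = scale c (\<eta> 1)"
  using linearD(3)[OF linear_eta, of c 1] by simp

lemma alpha_pow_eta: "(\<alpha> ^^ k) (\<eta> c) = \<eta> c"
proof -
  have "(\<alpha> ^^ k) (\<eta> 1) = \<eta> 1" by (induction k) (simp_all add: alpha_unit)
  then show ?thesis by (simp add: eta_eq[of c] linearD(3)[OF linear_alpha_pow])
qed

lemma alpha_pow_comm: "(\<alpha> ^^ k) ((\<alpha> ^^ l) x) = (\<alpha> ^^ (k + l)) x"
  by (simp add: funpow_add)

lemma alpha_pow_mono:
  assumes "(\<alpha> ^^ k) x = \<eta> c" "k \<le> l"
  shows "(\<alpha> ^^ l) x = \<eta> c"
  using alpha_pow_comm[of "l - k" k x] assms by (simp add: alpha_pow_eta)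

text \<open>Hom-associativity moves a bracket only next to a value of \<open>\<alpha>\<close>. Applying \<open>\<alpha>\<close> to the product
  turns \<open>c\<close> and \<open>d\<close> into such values, after which the bracket moves twice.\<close>

lemma alpha_mul_mul: "\<alpha> (mul (mul a b) (mul c d)) = mul (mul (\<alpha> a) (mul b c)) (\<alpha> (\<alpha> d))"
proof -
  have "\<alpha> (mul (mul a b) (mul c d)) = mul (\<alpha> (mul a b)) (mul (\<alpha> c) (\<alpha> d))"
    by (simp only: alpha_mul)
  also have "\<dots> = mul (mul (mul a b) (\<alpha> c)) (\<alpha> (\<alpha> d))"
    by (rule hom_assoc)
  also have "mul (mul a b) (\<alpha> c) = mul (\<alpha> a) (mul b c)"
    by (rule hom_assoc[symmetric])
  finally show ?thesis .
qed

text \<open>The inner pair \<open>f x\<close>, \<open>g x'\<close> is enclosed by \<open>f' y\<close> and \<open>g' y'\<close>. One power of \<open>\<alpha>\<close> puts the inner pair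
  in a common bracket (\<open>alpha_mul_mul\<close>), \<open>k\<close> further ones contract it to \<open>c\<close> times the unit, and the
  factor \<open>c\<close> leaves the outer sum. Multiplication by the unit is \<open>\<alpha>\<close>, which keeps the exponents
  on both outer factors equal.\<close>

lemma nested_convolution:
  assumes inner: "(\<alpha> ^^ k) (lin_ext scale (\<lambda>(x, x'). mul (f x) (g x')) u) = \<eta> c"
    and outer: "(\<alpha> ^^ l) (lin_ext scale (\<lambda>(y, y'). mul (f' y) (g' y')) v) = \<eta> d"
  shows "(\<alpha> ^^ (k + l + 1)) (lin_ext scale (\<lambda>(y, y').
      lin_ext scale (\<lambda>(x, x'). mul (mul (f' y) (f x)) (mul (g x') (g' y'))) u) v) = \<eta> (c * d)"
proof -
  note apply_ext = linear_apply_lin_ext[of scale scale]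
  let ?U = "lin_ext scale (\<lambda>(x, x'). mul (f x) (g x')) u"
  let ?V = "lin_ext scale (\<lambda>(y, y'). mul (f' y) (g' y')) v"
  let ?W = "\<lambda>y y'. lin_ext scale (\<lambda>(x, x'). mul (mul (f' y) (f x)) (mul (g x') (g' y'))) u"
  have step: "(\<alpha> ^^ (k + 1)) (?W y y') = (\<alpha> ^^ (k + 2)) (scale c (mul (f' y) (g' y')))" for y y'
  proof -
    have lin: "Vector_Spaces.linear scale scale (\<lambda>z. mul (mul (\<alpha> (f' y)) z) (\<alpha> (\<alpha> (g' y'))))"
      by (rule linear_comp2[OF linear_mul_right linear_mul_left])
    have "\<alpha> (?W y y') = mul (mul (\<alpha> (f' y)) ?U) (\<alpha> (\<alpha> (g' y')))"
      unfolding apply_ext[OF linear_alpha] apply_ext[OF lin] by (simp add: split_def alpha_mul_mul)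
    then have "(\<alpha> ^^ k) (\<alpha> (?W y y'))
        = mul (mul ((\<alpha> ^^ k) (\<alpha> (f' y))) (\<eta> c)) ((\<alpha> ^^ k) (\<alpha> (\<alpha> (g' y'))))"
      by (simp only: alpha_pow_mul inner)
    also have "\<dots> = (\<alpha> ^^ k) (\<alpha> (\<alpha> (scale c (mul (f' y) (g' y')))))"
      by (simp add: eta_eq[of c] linearD[OF linear_mul_right] linearD[OF linear_mul_left] mul_unit
          linearD[OF linear_alpha] linearD[OF linear_alpha_pow] alpha_mul alpha_pow_mul funpow_swap1)
    finally show ?thesis by (simp add: funpow_swap1)
  qed
  have "(\<alpha> ^^ (k + 1)) (lin_ext scale (\<lambda>(y, y'). ?W y y') v)
      = lin_ext scale (\<lambda>(y, y'). (\<alpha> ^^ (k + 2)) (scale c (mul (f' y) (g' y')))) v"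
    unfolding apply_ext[OF linear_alpha_pow, of _ _ v]
  proof (intro arg_cong[where f = "\<lambda>h. lin_ext scale h v"] ext)
    fix p
    show "(\<alpha> ^^ (k + 1)) (case p of (y, y') \<Rightarrow> ?W y y')
        = (case p of (y, y') \<Rightarrow> (\<alpha> ^^ (k + 2)) (scale c (mul (f' y) (g' y'))))"
      by (cases p) (simp only: prod.case step)
  qed
  also have "\<dots> = (\<alpha> ^^ (k + 2)) (scale c ?V)"
    unfolding apply_ext[OF linear_scale_self] apply_ext[OF linear_alpha_pow] by (simp only: split_def)
  finally have "(\<alpha> ^^ l) ((\<alpha> ^^ (k + 1)) (lin_ext scale (\<lambda>(y, y'). ?W y y') v))
      = (\<alpha> ^^ (k + 2)) (scale c ((\<alpha> ^^ l) ?V))"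
    by (simp only: alpha_pow_comm linearD(3)[OF linear_alpha_pow] add.commute)
  also have "\<dots> = \<eta> (c * d)"
    by (simp only: outer eta_eq[of d] scale_scale eta_eq[of "c * d", symmetric] alpha_pow_eta)
  finally show ?thesis by (simp only: alpha_pow_comm add.assoc add.commute[of _ l])
qed

end

context hom_bialgebra
begin

text \<open>Any representative of \<open>\<Delta> x\<close> may be used, which is what makes calculations with
  \<open>\<Delta> x = \<Sum> x\<^sub>1 \<otimes> x\<^sub>2\<close> possible.\<close>

lemma convolution_coset:
  assumes "Vector_Spaces.linear scale scale f" "Vector_Spaces.linear scale scale g"
    and "\<Delta> x = coset (tensor_rel scale) u"
  shows "convolution f g x = lin_ext scale (\<lambda>(x, y). mul (f x) (g y)) u"
  by (simp add: convolution_def assms(3) tensor_map_coset[OF assms(1,2)]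
      tensor_lift_coset[OF linear_mul_left linear_mul_right] lin_ext_lin_ext[OF vector_space_axioms]
      split_def lin_ext_gen[OF vector_space_axioms])

lemma linear_convolution:
  assumes "Vector_Spaces.linear scale scale f" "Vector_Spaces.linear scale scale g"
  shows "Vector_Spaces.linear scale scale (convolution f g)"
proof -
  note D = coset_rep[OF Delta_in, symmetric]
  note simps = convolution_coset[OF assms] linearD[OF linear_lin_ext[OF vector_space_axioms]]
  have "convolution f g (x + y) = convolution f g x + convolution f g y" for x y
  proof -
    have "\<Delta> (x + y) = coset (tensor_rel scale) (rep (\<Delta> x) + rep (\<Delta> y))"
      unfolding Delta_add tensor_add_def ..
    then show ?thesis
      unfolding convolution_coset[OF assms D[of x]] convolution_coset[OF assms D[of y]]
      by (simp only: simps)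
  qed
  moreover have "convolution f g (scale c x) = scale c (convolution f g x)" for c x
  proof -
    have "\<Delta> (scale c x) = coset (tensor_rel scale) (pscale c (rep (\<Delta> x)))"
      unfolding Delta_scale tensor_scale_def ..
    then show ?thesis
      unfolding convolution_coset[OF assms D[of x]] by (simp only: simps)
  qed
  ultimately show ?thesis
    unfolding Vector_Spaces.linear_iff using vector_space_axioms by blast
qed

text \<open>The condition on \<open>S\<close> at the single vector \<open>x\<close>, to be propagated along sums and products.\<close>

definition antipodal_at :: "('a \<Rightarrow> 'a) \<Rightarrow> 'a \<Rightarrow> bool"
  where "antipodal_at S x \<longleftrightarrow> (\<exists>k. (\<alpha> ^^ k) (convolution S id x) = \<eta> (\<epsilon> x) \<and>
    (\<alpha> ^^ k) (convolution id S x) = \<eta> (\<epsilon> x))"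

lemma linear_identity: "Vector_Spaces.linear scale scale id"
  by (simp add: Vector_Spaces.linear_iff vector_space_axioms)

text \<open>For \<open>S \<star> id\<close> the nesting has the components of \<open>\<Delta> x\<close> inside those of \<open>\<Delta> y\<close>, for \<open>id \<star> S\<close> it is the
  other way round. In both cases \<open>nested_convolution\<close> gives the exponent \<open>k + l + 1\<close>.\<close>

lemma antipodal_at_mul:
  assumes S: "Vector_Spaces.linear scale scale S" and anti: "\<And>x y. S (mul x y) = mul (S y) (S x)"
    and "antipodal_at S x" "antipodal_at S y"
  shows "antipodal_at S (mul x y)"
proof -
  note D = coset_rep[OF Delta_in, symmetric]
  let ?u = "rep (\<Delta> x)" and ?v = "rep (\<Delta> y)"
  have Dxy: "\<Delta> (mul x y) = coset (tensor_rel scale) (comp_mult mul ?u ?v)"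
    unfolding Delta_mul tensor_mult_def ..
  note left = convolution_coset[OF S linear_identity] and right = convolution_coset[OF linear_identity S]
  from assms(3) obtain k where k:
    "(\<alpha> ^^ k) (convolution S id x) = \<eta> (\<epsilon> x)" "(\<alpha> ^^ k) (convolution id S x) = \<eta> (\<epsilon> x)"
    unfolding antipodal_at_def by blast
  from assms(4) obtain l where l:
    "(\<alpha> ^^ l) (convolution S id y) = \<eta> (\<epsilon> y)" "(\<alpha> ^^ l) (convolution id S y) = \<eta> (\<epsilon> y)"
    unfolding antipodal_at_def by blast
  have "convolution S id (mul x y) = lin_ext scale (\<lambda>(y, y'). lin_ext scale
      (\<lambda>(x, x'). mul (mul (S y) (S x)) (mul (id x') (id y'))) ?u) ?v"
    unfolding left[OF Dxy] lin_ext_comp_mult[OF vector_space_axioms] split_def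
    by (subst lin_ext_swap[OF vector_space_axioms]) (simp add: anti)
  with nested_convolution[OF k(1)[unfolded left[OF D]] l(1)[unfolded left[OF D]]]
  have 1: "(\<alpha> ^^ (k + l + 1)) (convolution S id (mul x y)) = \<eta> (\<epsilon> (mul x y))"
    by (simp only: eps_mul)
  have "convolution id S (mul x y) = lin_ext scale (\<lambda>(x, x'). lin_ext scale
      (\<lambda>(y, y'). mul (mul (id x) (id y)) (mul (S y') (S x'))) ?v) ?u"
    unfolding right[OF Dxy] lin_ext_comp_mult[OF vector_space_axioms] split_def
    by (simp add: anti)
  with nested_convolution[OF l(2)[unfolded right[OF D]] k(2)[unfolded right[OF D]]]
  have 2: "(\<alpha> ^^ (k + l + 1)) (convolution id S (mul x y)) = \<eta> (\<epsilon> (mul x y))"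
    by (simp only: eps_mul mult.commute add.commute[of l k])
  from 1 2 show ?thesis unfolding antipodal_at_def by blast
qed

text \<open>Powers of \<open>\<alpha>\<close> fix the multiples of the unit, so exponents may be enlarged and two vectors have a
  common one.\<close>

lemma subspace_antipodal_at:
  assumes S: "Vector_Spaces.linear scale scale S"
  shows "subspace {x. antipodal_at S x}"
proof (rule subspaceI)
  note simps = linearD[OF linear_convolution[OF S linear_identity]] linearD[OF linear_convolution[OF linear_identity S]]
    linearD[OF linear_alpha_pow] linearD[OF linear_eps] linearD[OF linear_eta]
  show "0 \<in> {x. antipodal_at S x}"
    by (simp add: antipodal_at_def simps)
  fix x assume "x \<in> {x. antipodal_at S x}"
  then obtain k where k:
    "(\<alpha> ^^ k) (convolution S id x) = \<eta> (\<epsilon> x)" "(\<alpha> ^^ k) (convolution id S x) = \<eta> (\<epsilon> x)"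
    unfolding antipodal_at_def by blast
  show "scale c x \<in> {x. antipodal_at S x}" for c
    unfolding antipodal_at_def mem_Collect_eq by (rule exI[of _ k]) (simp add: simps k)
  fix y assume "y \<in> {x. antipodal_at S x}"
  then obtain l where l:
    "(\<alpha> ^^ l) (convolution S id y) = \<eta> (\<epsilon> y)" "(\<alpha> ^^ l) (convolution id S y) = \<eta> (\<epsilon> y)"
    unfolding antipodal_at_def by blast
  show "x + y \<in> {x. antipodal_at S x}"
    unfolding antipodal_at_def mem_Collect_eq
    by (rule exI[of _ "max k l"])
      (simp add: simps alpha_pow_mono[OF k(1)] alpha_pow_mono[OF k(2)] alpha_pow_mono[OF l(1)] alpha_pow_mono[OF l(2)])
qed

end


section \<open>The coproduct on the basis\<close>

text \<open>By this rule, two maps on \<open>B\<close> that are compatible with the product agree as soon as they agree on the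
  generators \<open>\<one>\<close> and \<open>(|, a)\<close>.\<close>

lemma basis_vee_induct [case_names One Leaf vee]:
  assumes "P One" "\<And>a. P (Tree (Leaf a))" "\<And>b c. P b \<Longrightarrow> P c \<Longrightarrow> P (basis_vee b c)"
  shows "P b"
proof -
  have "P (Tree t)" for t
  proof (induction t)
    case (Graft s t)
    from assms(3)[OF this] show ?case by simp
  qed (rule assms(2))
  with assms(1) show ?thesis by (cases b) auto
qed

text \<open>The coproduct of \<open>\<bbbT>\<close>, with \<open>\<bbbT> \<otimes> \<bbbT>\<close> realised as the free space on pairs of basis elements, so that
  no cosets occur. It is defined by multiplicativity instead of a sum over splittings of the leaves,
  because this is the form in which inductions on trees use it; the two descriptions are compared in
  \<open>proj_Delta_eq_free_Delta\<close>.\<close>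

fun wtree_Delta :: "wtree \<Rightarrow> (basis \<times> basis) \<Rightarrow>\<^sub>0 'k::field" where
  "wtree_Delta (Leaf a) = gen (Tree (Leaf a), One) + gen (One, Tree (Leaf a))"
| "wtree_Delta (Graft s t) = comp_mult basis_vee (wtree_Delta s) (wtree_Delta t)"

fun free_Delta :: "basis \<Rightarrow> (basis \<times> basis) \<Rightarrow>\<^sub>0 'k::field" where
  "free_Delta One = gen (One, One)"
| "free_Delta (Tree t) = wtree_Delta t"

lemmas comp_mult_simps = linearD[OF linear_comp_mult1] linearD[OF linear_comp_mult2]
lemmas lin_ext_simps = linearD[OF linear_lin_ext[OF vector_space_pscale]]

lemma comp_mult_One_left:
  "comp_mult basis_vee (gen (One, One)) u
    = lin_ext pscale (\<lambda>(x, y). gen (basis_alpha x, basis_alpha y)) u"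
  by (simp add: comp_mult_def)

lemma comp_mult_One_right:
  "comp_mult basis_vee u (gen (One, One))
    = lin_ext pscale (\<lambda>(x, y). gen (basis_alpha x, basis_alpha y)) u"
  by (simp add: comp_mult_def)

lemma wtree_Delta_alpha:
  "wtree_Delta (wtree_alpha t)
    = lin_ext pscale (\<lambda>(x, y). gen (basis_alpha x, basis_alpha y)) (wtree_Delta t)"
proof (induction t)
  case (Leaf a)
  show ?case by (simp add: lin_ext_add)
next
  case (Graft s t)
  let ?a = "lin_ext pscale (\<lambda>(x, y). gen (basis_alpha x, basis_alpha y))"
  have "?a (comp_mult basis_vee u v) = comp_mult basis_vee (?a u) (?a v)" for u v :: "(basis \<times> basis) \<Rightarrow>\<^sub>0 'a"
    by (rule bilinear_gen_eqI[where s = pscale])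
      (auto simp: Vector_Spaces.linear_iff vector_space_pscale comp_mult_simps lin_ext_simps basis_alpha_vee)
  with Graft show ?case by simp
qed

text \<open>The cases in which one factor is \<open>\<one>\<close> are not part of the definition. They hold because
  multiplication by \<open>\<one> \<otimes> \<one>\<close> is \<open>\<alpha> \<otimes> \<alpha>\<close>, which commutes with the coproduct.\<close>

lemma free_Delta_vee: "free_Delta (basis_vee b c) = comp_mult basis_vee (free_Delta b) (free_Delta c)"
  by (cases b; cases c)
    (simp_all add: wtree_Delta_alpha comp_mult_One_left comp_mult_One_right)

text \<open>The map \<open>\<pi> \<otimes> \<pi>\<close>, where \<open>\<pi>\<close> is the quotient map.\<close>

definition free_proj :: "((basis \<times> basis) \<Rightarrow>\<^sub>0 'k::field) \<Rightarrow> ('k TI \<times> 'k TI) \<Rightarrow>\<^sub>0 'k"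
  where "free_proj = lin_ext pscale (\<lambda>(x, y). gen (abs_TI (gen x), abs_TI (gen y)))"

lemma free_proj_gen [simp]: "free_proj (gen (x, y)) = gen (abs_TI (gen x), abs_TI (gen y))"
  by (simp add: free_proj_def)

lemma linear_free_proj: "Vector_Spaces.linear pscale pscale free_proj"
  unfolding free_proj_def by (rule linear_lin_ext[OF vector_space_pscale])

lemma free_proj_comp_mult:
  "free_proj (comp_mult basis_vee u v) = comp_mult TI_vee (free_proj u) (free_proj v)"
  by (rule bilinear_gen_eqI[where s = pscale])
    (auto simp: Vector_Spaces.linear_iff vector_space_pscale comp_mult_simps
      linearD[OF linear_free_proj] abs_TI_basis_vee)

lemma proj_Delta_Leaf:
  "proj_Delta (gen (Tree (Leaf a)))
    = gen (abs_TI (gen (Tree (Leaf a))), TI_one) + gen (TI_one, abs_TI (gen (Tree (Leaf a))))"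
proof -
  have "I \<union> J = {1::nat} \<and> I \<inter> J = {} \<longleftrightarrow> (I, J) = ({1}, {}) \<or> (I, J) = ({}, {1})" for I J
    by (cases "I = {}"; cases "J = {}") (auto simp: Un_singleton_iff)
  then have "splits 1 = {({1}, {}), ({}, {1})}"
    unfolding atLeastAtMost_singleton by auto
  then show ?thesis by (simp add: proj_Delta_Tree TI_one.abs_eq)
qed

text \<open>Both sides are multiplicative and agree on generators.\<close>

lemma proj_Delta_eq_free_Delta: "proj_Delta (gen b) = free_proj (free_Delta b)"
proof (induction b rule: basis_vee_induct)
  case (vee b c)
  then show ?case by (simp add: proj_Delta_basis_vee free_Delta_vee free_proj_comp_mult)
qed (simp_all add: proj_Delta_One proj_Delta_Leaf linearD[OF linear_free_proj] TI_one.abs_eq)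

section \<open>Coassociativity\<close>

definition comp_mult3 :: "('a \<Rightarrow> 'a \<Rightarrow> 'a) \<Rightarrow> (('a \<times> 'a \<times> 'a) \<Rightarrow>\<^sub>0 'k::field)
    \<Rightarrow> (('a \<times> 'a \<times> 'a) \<Rightarrow>\<^sub>0 'k) \<Rightarrow> (('a \<times> 'a \<times> 'a) \<Rightarrow>\<^sub>0 'k)"
  where "comp_mult3 m u v = lin_ext pscale (\<lambda>(x, y, z).
    lin_ext pscale (\<lambda>(x', y', z'). gen (m x x', m y y', m z z')) v) u"

lemma comp_mult3_gen [simp]:
  "comp_mult3 m (gen (x, y, z)) (gen (x', y', z')) = gen (m x x', m y y', m z z')"
  by (simp add: comp_mult3_def)

lemma linear_comp_mult3_1: "Vector_Spaces.linear pscale pscale (\<lambda>u. comp_mult3 m u v)"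
  unfolding comp_mult3_def by (rule linear_lin_ext[OF vector_space_pscale])

lemma linear_comp_mult3_2: "Vector_Spaces.linear pscale pscale (comp_mult3 m u)"
  unfolding comp_mult3_def
  by (rule lin_ext_param[OF vector_space_pscale])
    (auto simp: split_def intro: linear_lin_ext[OF vector_space_pscale])

text \<open>The tensors \<open>x \<otimes> u\<close> and \<open>u \<otimes> z\<close> for an element \<open>u\<close> of the second tensor power.\<close>

definition attach_left :: "'x \<Rightarrow> (('x \<times> 'x) \<Rightarrow>\<^sub>0 'k::field) \<Rightarrow> ('x \<times> 'x \<times> 'x) \<Rightarrow>\<^sub>0 'k"
  where "attach_left x = lin_ext pscale (\<lambda>(y, z). gen (x, y, z))"

definition attach_right :: "(('x \<times> 'x) \<Rightarrow>\<^sub>0 'k::field) \<Rightarrow> 'x \<Rightarrow> ('x \<times> 'x \<times> 'x) \<Rightarrow>\<^sub>0 'k"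
  where "attach_right u z = lin_ext pscale (\<lambda>(x, y). gen (x, y, z)) u"

lemma attach_gen [simp]:
  "attach_left x (gen (y, z)) = gen (x, y, z)" "attach_right (gen (x, y)) z = gen (x, y, z)"
  by (simp_all add: attach_left_def attach_right_def)

lemma linear_attach_left: "Vector_Spaces.linear pscale pscale (attach_left x)"
  unfolding attach_left_def by (rule linear_lin_ext[OF vector_space_pscale])

lemma linear_attach_right: "Vector_Spaces.linear pscale pscale (\<lambda>u. attach_right u z)"
  unfolding attach_right_def by (rule linear_lin_ext[OF vector_space_pscale])

lemmas attach_simps = linearD[OF linear_attach_left] linearD[OF linear_attach_right]

lemma attach_comp_mult:
  "attach_left (m x x') (comp_mult m u v) = comp_mult3 m (attach_left x u) (attach_left x' v)"
  "attach_right (comp_mult m u v) (m x x') = comp_mult3 m (attach_right u x) (attach_right v x')"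
proof -
  show "attach_left (m x x') (comp_mult m u v) = comp_mult3 m (attach_left x u) (attach_left x' v)"
    by (rule bilinear_gen_eqI[where f = "\<lambda>u v. attach_left (m x x') (comp_mult m u v)"
          and g = "\<lambda>u v. comp_mult3 m (attach_left x u) (attach_left x' v)" and s = pscale])
      (rule linear_comp2[OF linear_comp_mult1 linear_attach_left]
        linear_comp2[OF linear_comp_mult2 linear_attach_left]
        linear_comp2[OF linear_attach_left linear_comp_mult3_1]
        linear_comp2[OF linear_attach_left linear_comp_mult3_2] | clarsimp)+
  show "attach_right (comp_mult m u v) (m x x') = comp_mult3 m (attach_right u x) (attach_right v x')"
    by (rule bilinear_gen_eqI[where f = "\<lambda>u v. attach_right (comp_mult m u v) (m x x')"
          and g = "\<lambda>u v. comp_mult3 m (attach_right u x) (attach_right v x')" and s = pscale])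
      (rule linear_comp2[OF linear_comp_mult1 linear_attach_right]
        linear_comp2[OF linear_comp_mult2 linear_attach_right]
        linear_comp2[OF linear_attach_right linear_comp_mult3_1]
        linear_comp2[OF linear_attach_right linear_comp_mult3_2] | clarsimp)+
qed

text \<open>The maps \<open>id \<otimes> \<Delta>\<close> and \<open>\<Delta> \<otimes> id\<close>, for the coproduct of \<open>\<bbbT>\<close>.\<close>

definition Delta_second :: "((basis \<times> basis) \<Rightarrow>\<^sub>0 'k::field) \<Rightarrow> (basis \<times> basis \<times> basis) \<Rightarrow>\<^sub>0 'k"
  where "Delta_second = lin_ext pscale (\<lambda>(x, y). attach_left x (free_Delta y))"

definition Delta_first :: "((basis \<times> basis) \<Rightarrow>\<^sub>0 'k::field) \<Rightarrow> (basis \<times> basis \<times> basis) \<Rightarrow>\<^sub>0 'k"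
  where "Delta_first = lin_ext pscale (\<lambda>(x, y). attach_right (free_Delta x) y)"

lemma Delta_slot_gen [simp]:
  "Delta_second (gen (x, y)) = attach_left x (free_Delta y)"
  "Delta_first (gen (x, y)) = attach_right (free_Delta x) y"
  by (simp_all add: Delta_second_def Delta_first_def)

lemma linear_Delta_slot:
  "Vector_Spaces.linear pscale pscale Delta_second" "Vector_Spaces.linear pscale pscale Delta_first"
  unfolding Delta_second_def Delta_first_def by (rule linear_lin_ext[OF vector_space_pscale])+

lemmas Delta_slot_simps = linear_Delta_slot[THEN linearD(1)] linear_Delta_slot[THEN linearD(3)]

lemma Delta_slot_comp_mult:
  "Delta_second (comp_mult basis_vee u v) = comp_mult3 basis_vee (Delta_second u) (Delta_second v)"
  "Delta_first (comp_mult basis_vee u v) = comp_mult3 basis_vee (Delta_first u) (Delta_first v)"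
proof -
  show "Delta_second (comp_mult basis_vee u v) = comp_mult3 basis_vee (Delta_second u) (Delta_second v)"
    by (rule bilinear_gen_eqI[where f = "\<lambda>u v. Delta_second (comp_mult basis_vee u v)"
          and g = "\<lambda>u v. comp_mult3 basis_vee (Delta_second u) (Delta_second v)" and s = pscale])
      (rule linear_comp2[OF linear_comp_mult1 linear_Delta_slot(1)]
        linear_comp2[OF linear_comp_mult2 linear_Delta_slot(1)]
        linear_comp2[OF linear_Delta_slot(1) linear_comp_mult3_1]
        linear_comp2[OF linear_Delta_slot(1) linear_comp_mult3_2]
        | clarsimp simp: free_Delta_vee attach_comp_mult)+
  show "Delta_first (comp_mult basis_vee u v) = comp_mult3 basis_vee (Delta_first u) (Delta_first v)"
    by (rule bilinear_gen_eqI[where f = "\<lambda>u v. Delta_first (comp_mult basis_vee u v)"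
          and g = "\<lambda>u v. comp_mult3 basis_vee (Delta_first u) (Delta_first v)" and s = pscale])
      (rule linear_comp2[OF linear_comp_mult1 linear_Delta_slot(2)]
        linear_comp2[OF linear_comp_mult2 linear_Delta_slot(2)]
        linear_comp2[OF linear_Delta_slot(2) linear_comp_mult3_1]
        linear_comp2[OF linear_Delta_slot(2) linear_comp_mult3_2]
        | clarsimp simp: free_Delta_vee attach_comp_mult)+
qed

text \<open>Both sides are multiplicative in \<open>b\<close>. On a leaf \<open>x\<close> both are the sum of \<open>x \<otimes> \<one> \<otimes> \<one>\<close>, \<open>\<one> \<otimes> x \<otimes> \<one>\<close> and
  \<open>\<one> \<otimes> \<one> \<otimes> x\<close>.\<close>

lemma free_Delta_coassoc: "Delta_second (free_Delta b) = Delta_first (free_Delta b)"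
proof (induction b rule: basis_vee_induct)
  case (vee b c)
  then show ?case by (simp add: free_Delta_vee Delta_slot_comp_mult)
next case One show ?case by simp
next case (Leaf a) show ?case by (simp add: Delta_slot_simps attach_simps)
qed

lemma subspace_tensor3_rel: "module.subspace pscale (tensor3_rel s)"
  unfolding tensor3_rel_def by (rule pm.subspace_span)

lemma coset3_eqI:
  assumes "u - v \<in> tensor3_rel s"
  shows "coset (tensor3_rel s) u = coset (tensor3_rel s) v"
proof -
  have "w - u \<in> tensor3_rel s \<longleftrightarrow> w - v \<in> tensor3_rel s" for w
    using pm.subspace_add[OF subspace_tensor3_rel _ assms, of "w - u"]
      pm.subspace_diff[OF subspace_tensor3_rel _ assms, of "w - v"] by auto
  then show ?thesis by (auto simp: coset_def)
qed

lemma slot_rel_gen: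
  "gen (f (x + y)) - gen (f x) - gen (f y) \<in> slot_rel s f"
  "gen (f (s c x)) - pscale c (gen (f x)) \<in> slot_rel s f"
  unfolding slot_rel_def by blast+

lemma slot_rel_tensor3:
  "u \<in> slot_rel s (\<lambda>x. (x, y, z)) \<Longrightarrow> u \<in> tensor3_rel s"
  "u \<in> slot_rel s (\<lambda>y. (x, y, z)) \<Longrightarrow> u \<in> tensor3_rel s"
  "u \<in> slot_rel s (\<lambda>z. (x, y, z)) \<Longrightarrow> u \<in> tensor3_rel s"
  unfolding tensor3_rel_def
  by (rule pm.span_base, (rule UnI1)+, (rule UN_I[OF UNIV_I])+, assumption)
    (rule pm.span_base, rule UnI1, rule UnI2, (rule UN_I[OF UNIV_I])+, assumption,
      rule pm.span_base, rule UnI2, (rule UN_I[OF UNIV_I])+, assumption)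

lemmas tensor3_rel_gen = slot_rel_tensor3(1)[OF slot_rel_gen(1)] slot_rel_tensor3(1)[OF slot_rel_gen(2)]
  slot_rel_tensor3(2)[OF slot_rel_gen(1)] slot_rel_tensor3(2)[OF slot_rel_gen(2)]
  slot_rel_tensor3(3)[OF slot_rel_gen(1)] slot_rel_tensor3(3)[OF slot_rel_gen(2)]

lemma attach_tensor_rel:
  assumes "u \<in> tensor_rel s"
  shows "attach_left x u \<in> tensor3_rel s" "attach_right u x \<in> tensor3_rel s"
  unfolding attach_left_def attach_right_def
  by (rule lin_ext_tensor_rel_in[OF subspace_tensor3_rel vector_space_pscale _ _ _ _ assms];
      rule tensor3_rel_gen)+

lemma attach_slot:
  "attach_left (x + x') u - attach_left x u - attach_left x' u \<in> tensor3_rel s"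
  "attach_left (s c x) u - pscale c (attach_left x u) \<in> tensor3_rel s"
  "attach_right u (x + x') - attach_right u x - attach_right u x' \<in> tensor3_rel s"
  "attach_right u (s c x) - pscale c (attach_right u x) \<in> tensor3_rel s"
proof -
  note lin = linear_attach_left linear_attach_right
  note scaled = lin[THEN linear_comp2, OF pm.linear_scale_self]
  note subI = linear_gen_subspaceI[OF _ subspace_tensor3_rel, of _ s u]
  show "attach_left (x + x') u - attach_left x u - attach_left x' u \<in> tensor3_rel s"
    by (rule subI[where f = "\<lambda>u. attach_left (x + x') u - attach_left x u - attach_left x' u"])
      (intro linear_sub lin, auto simp: tensor3_rel_gen)
  show "attach_left (s c x) u - pscale c (attach_left x u) \<in> tensor3_rel s"
    by (rule subI[where f = "\<lambda>u. attach_left (s c x) u - pscale c (attach_left x u)"])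
      (intro linear_sub lin scaled, auto simp: tensor3_rel_gen)
  show "attach_right u (x + x') - attach_right u x - attach_right u x' \<in> tensor3_rel s"
    by (rule subI[where f = "\<lambda>u. attach_right u (x + x') - attach_right u x - attach_right u x'"])
      (intro linear_sub lin, auto simp: tensor3_rel_gen)
  show "attach_right u (s c x) - pscale c (attach_right u x) \<in> tensor3_rel s"
    by (rule subI[where f = "\<lambda>u. attach_right u (s c x) - pscale c (attach_right u x)"])
      (intro linear_sub lin scaled, auto simp: tensor3_rel_gen)
qed

section \<open>The quotient as a Hom-bialgebra\<close>

lemma TI_Delta_abs_coset: "TI_Delta (abs_TI z) = coset (tensor_rel TI_scale) (proj_Delta z)"
  unfolding TI_Delta_abs T_Delta_def proj_Delta_def by (rule tensor_map_coset[OF linear_abs_TI linear_abs_TI])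

lemma abs_TI_cases [cases type: TI]: obtains z where "x = abs_TI z"
  by (metis Quotient3_TI Quotient3_abs_rep)

lemma rep_TI_Delta_abs: "rep (TI_Delta (abs_TI z)) - proj_Delta z \<in> tensor_rel TI_scale"
  unfolding TI_Delta_abs_coset by (rule rep_coset)

lemma TI_Delta_add: "TI_Delta (x + y) = tensor_add TI_scale (TI_Delta x) (TI_Delta y)"
  by (cases x; cases y)
    (simp add: plus_TI.abs_eq TI_Delta_abs_coset tensor_add_coset linearD[OF linear_proj_Delta])

lemma TI_Delta_scale: "TI_Delta (TI_scale c x) = tensor_scale TI_scale c (TI_Delta x)"
  by (cases x)
    (simp add: TI_scale.abs_eq TI_Delta_abs_coset tensor_scale_coset linearD[OF linear_proj_Delta])

lemma rep_TI_Delta_add: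
  "rep (TI_Delta (x + y)) - rep (TI_Delta x) - rep (TI_Delta y) \<in> tensor_rel TI_scale"
  using rep_coset[of TI_scale "rep (TI_Delta x) + rep (TI_Delta y)"]
  by (simp add: TI_Delta_add tensor_add_def diff_diff_eq)

lemma rep_TI_Delta_scale:
  "rep (TI_Delta (TI_scale c x)) - pscale c (rep (TI_Delta x)) \<in> tensor_rel TI_scale"
  unfolding TI_Delta_scale tensor_scale_def by (rule rep_coset)

text \<open>Representatives of \<open>id \<otimes> \<Delta>\<close> and \<open>\<Delta> \<otimes> id\<close> on the quotient. They involve a choice of representatives
  of the values of \<open>\<Delta>\<close>, and are well defined on tensors only modulo the relations of the third tensor
  power; this is \<open>TI_Delta_slot_tensor_rel\<close>.\<close>

definition TI_Delta_second :: "(('k::field TI \<times> 'k TI) \<Rightarrow>\<^sub>0 'k) \<Rightarrow> ('k TI \<times> 'k TI \<times> 'k TI) \<Rightarrow>\<^sub>0 'k"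
  where "TI_Delta_second = lin_ext pscale (\<lambda>(x, y). attach_left x (rep (TI_Delta y)))"

definition TI_Delta_first :: "(('k::field TI \<times> 'k TI) \<Rightarrow>\<^sub>0 'k) \<Rightarrow> ('k TI \<times> 'k TI \<times> 'k TI) \<Rightarrow>\<^sub>0 'k"
  where "TI_Delta_first = lin_ext pscale (\<lambda>(x, y). attach_right (rep (TI_Delta x)) y)"

lemma linear_TI_Delta_slot:
  "Vector_Spaces.linear pscale pscale TI_Delta_second" "Vector_Spaces.linear pscale pscale TI_Delta_first"
  unfolding TI_Delta_second_def TI_Delta_first_def by (rule linear_lin_ext[OF vector_space_pscale])+

lemma TI_Delta_slot_tensor_rel:
  assumes "u \<in> tensor_rel TI_scale"
  shows "TI_Delta_second u \<in> tensor3_rel TI_scale" "TI_Delta_first u \<in> tensor3_rel TI_scale"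
proof -
  have left: "attach_left x (rep (TI_Delta (y + y'))) - attach_left x (rep (TI_Delta y))
      - attach_left x (rep (TI_Delta y')) \<in> tensor3_rel TI_scale"
    and right: "attach_right (rep (TI_Delta (y + y'))) x - attach_right (rep (TI_Delta y)) x
      - attach_right (rep (TI_Delta y')) x \<in> tensor3_rel TI_scale" for x y y' :: "'a TI"
    using rep_TI_Delta_add[of y y', THEN attach_tensor_rel(1), of x]
      rep_TI_Delta_add[of y y', THEN attach_tensor_rel(2), of x]
    by (simp_all only: attach_simps)
  have left': "attach_left x (rep (TI_Delta (TI_scale c y))) - pscale c (attach_left x (rep (TI_Delta y)))
      \<in> tensor3_rel TI_scale"
    and right': "attach_right (rep (TI_Delta (TI_scale c y))) x - pscale c (attach_right (rep (TI_Delta y)) x)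
      \<in> tensor3_rel TI_scale" for c and x y :: "'a TI"
    using rep_TI_Delta_scale[of c y, THEN attach_tensor_rel(1), of x]
      rep_TI_Delta_scale[of c y, THEN attach_tensor_rel(2), of x]
    by (simp_all only: attach_simps)
  show "TI_Delta_second u \<in> tensor3_rel TI_scale"
    unfolding TI_Delta_second_def
    by (rule lin_ext_tensor_rel_in[OF subspace_tensor3_rel vector_space_pscale _ _ _ _ assms])
      (rule attach_slot left left')+
  show "TI_Delta_first u \<in> tensor3_rel TI_scale"
    unfolding TI_Delta_first_def
    by (rule lin_ext_tensor_rel_in[OF subspace_tensor3_rel vector_space_pscale _ _ _ _ assms])
      (rule attach_slot right right')+
qed

definition free_proj3 :: "((basis \<times> basis \<times> basis) \<Rightarrow>\<^sub>0 'k::field) \<Rightarrow> ('k TI \<times> 'k TI \<times> 'k TI) \<Rightarrow>\<^sub>0 'k"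
  where "free_proj3 = lin_ext pscale (\<lambda>(x, y, z). gen (abs_TI (gen x), abs_TI (gen y), abs_TI (gen z)))"

lemma free_proj3_gen [simp]:
  "free_proj3 (gen (x, y, z)) = gen (abs_TI (gen x), abs_TI (gen y), abs_TI (gen z))"
  by (simp add: free_proj3_def)

lemma linear_free_proj3: "Vector_Spaces.linear pscale pscale free_proj3"
  unfolding free_proj3_def by (rule linear_lin_ext[OF vector_space_pscale])

lemma free_proj3_attach:
  "free_proj3 (attach_left x u) = attach_left (abs_TI (gen x)) (free_proj u)"
  "free_proj3 (attach_right u x) = attach_right (free_proj u) (abs_TI (gen x))"
  by (rule linear_gen_eqI[OF linear_comp2[OF linear_attach_left linear_free_proj3]
        linear_comp2[OF linear_free_proj linear_attach_left]], clarsimp)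
    (rule linear_gen_eqI[OF linear_comp2[OF linear_attach_right linear_free_proj3]
        linear_comp2[OF linear_free_proj linear_attach_right]], clarsimp)

text \<open>The chosen representative of \<open>\<Delta> (\<pi> b)\<close> differs from the image of \<open>free_Delta b\<close> by a relation of the tensor
  square, and attaching a third factor turns this into a relation of the tensor cube.\<close>

lemma TI_Delta_slot_free_proj:
  "TI_Delta_second (free_proj u) - free_proj3 (Delta_second u) \<in> tensor3_rel TI_scale"
  "TI_Delta_first (free_proj u) - free_proj3 (Delta_first u) \<in> tensor3_rel TI_scale"
proof -
  have *: "rep (TI_Delta (abs_TI (gen b))) - free_proj (free_Delta b) \<in> tensor_rel TI_scale" for b
    using rep_TI_Delta_abs[of "gen b"] by (simp add: proj_Delta_eq_free_Delta)
  show "TI_Delta_second (free_proj u) - free_proj3 (Delta_second u) \<in> tensor3_rel TI_scale"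
  proof (rule linear_gen_subspaceI[OF linear_sub subspace_tensor3_rel, where u = u])
    fix p :: "basis \<times> basis"
    show "TI_Delta_second (free_proj (gen p)) - free_proj3 (Delta_second (gen p)) \<in> tensor3_rel TI_scale"
      using attach_tensor_rel(1)[OF *[of "snd p"], of "abs_TI (gen (fst p))"]
      by (cases p) (simp add: TI_Delta_second_def free_proj3_attach attach_simps)
  qed (rule linear_comp2[OF linear_free_proj linear_TI_Delta_slot(1)]
      linear_comp2[OF linear_Delta_slot(1) linear_free_proj3])+
  show "TI_Delta_first (free_proj u) - free_proj3 (Delta_first u) \<in> tensor3_rel TI_scale"
  proof (rule linear_gen_subspaceI[OF linear_sub subspace_tensor3_rel, where u = u])
    fix p :: "basis \<times> basis"
    show "TI_Delta_first (free_proj (gen p)) - free_proj3 (Delta_first (gen p)) \<in> tensor3_rel TI_scale"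
      using attach_tensor_rel(2)[OF *[of "fst p"], of "abs_TI (gen (snd p))"]
      by (cases p) (simp add: TI_Delta_first_def free_proj3_attach attach_simps)
  qed (rule linear_comp2[OF linear_free_proj linear_TI_Delta_slot(2)]
      linear_comp2[OF linear_Delta_slot(2) linear_free_proj3])+
qed

lemma TI_Delta_slots_proj_Delta:
  "TI_Delta_second (proj_Delta z) - TI_Delta_first (proj_Delta z) \<in> tensor3_rel TI_scale"
proof (rule linear_gen_subspaceI[OF linear_sub subspace_tensor3_rel, where u = z])
  fix b
  show "TI_Delta_second (proj_Delta (gen b)) - TI_Delta_first (proj_Delta (gen b)) \<in> tensor3_rel TI_scale"
    using pm.subspace_diff[OF subspace_tensor3_rel TI_Delta_slot_free_proj, of "free_Delta b" "free_Delta b"]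
    by (simp add: proj_Delta_eq_free_Delta free_Delta_coassoc)
qed (rule linear_comp2[OF linear_proj_Delta linear_TI_Delta_slot(1)]
    linear_comp2[OF linear_proj_Delta linear_TI_Delta_slot(2)])+

lemma TI_hom_coassoc:
  "tensor_map_right TI_scale id TI_Delta (TI_Delta x) = tensor_map_left TI_scale TI_Delta id (TI_Delta x)"
proof -
  obtain z where x: "x = abs_TI z" by (cases x)
  let ?D = "TI_Delta x"
  \<comment> \<open>The given representative \<open>rep ?D\<close> is traded for \<open>proj_Delta z\<close>, where coassociativity is known.\<close>
  have "TI_Delta_second (rep ?D - proj_Delta z) - TI_Delta_first (rep ?D - proj_Delta z)
      + (TI_Delta_second (proj_Delta z) - TI_Delta_first (proj_Delta z)) \<in> tensor3_rel TI_scale"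
    unfolding x
    by (intro pm.subspace_add pm.subspace_diff subspace_tensor3_rel TI_Delta_slot_tensor_rel
        TI_Delta_slots_proj_Delta rep_TI_Delta_abs)
  then have "TI_Delta_second (rep ?D) - TI_Delta_first (rep ?D) \<in> tensor3_rel TI_scale"
    by (simp add: linear_TI_Delta_slot[THEN linearD(2)])
  then have "coset (tensor3_rel TI_scale) (TI_Delta_second (rep ?D))
      = coset (tensor3_rel TI_scale) (TI_Delta_first (rep ?D))"
    by (rule coset3_eqI)
  then show ?thesis
    by (simp add: tensor_map_right_def tensor_map_left_def TI_Delta_second_def TI_Delta_first_def
        attach_left_def attach_right_def)
qed

lemma linear_TI_alpha: "Vector_Spaces.linear TI_scale TI_scale TI_alpha"
  unfolding Vector_Spaces.linear_iff
  by (intro conjI vector_space_TI_scale allI; transfer)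
    (simp_all add: T_alpha_simps pm.subspace_0[OF subspace_hom_assoc_ideal])

lemma linear_TI_eps: "Vector_Spaces.linear TI_scale (*) TI_eps"
  unfolding Vector_Spaces.linear_iff
  by (intro conjI vector_space_TI_scale vector_space_mult allI; transfer) (simp_all add: T_eps_simps)

lemma linear_TI_S: "Vector_Spaces.linear TI_scale TI_scale TI_S"
  unfolding Vector_Spaces.linear_iff
  by (intro conjI vector_space_TI_scale allI; transfer)
    (simp_all add: T_S_simps pm.subspace_0[OF subspace_hom_assoc_ideal])

lemma TI_eps_vee: "TI_eps (TI_vee x y) = TI_eps x * TI_eps y"
  by transfer (rule T_eps_vee)

lemma TI_unit_1: "TI_unit 1 = TI_one"
  using vector_space.vector_space_assms(4)[OF vector_space_TI_scale] by (simp add: TI_unit_def)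

lemma unital_hom_associative_algebra_TI:
  "unital_hom_associative_algebra TI_scale TI_vee TI_alpha TI_unit"
proof -
  interpret vector_space "TI_scale :: 'a \<Rightarrow> 'a TI \<Rightarrow> 'a TI" by (rule vector_space_TI_scale)
  note zero = pm.subspace_0[OF subspace_hom_assoc_ideal]
  show ?thesis
  proof (intro unital_hom_associative_algebra.intro unital_hom_associative_algebra_axioms.intro
      vector_space_axioms)
    show "Vector_Spaces.linear (*) TI_scale (TI_unit :: 'a \<Rightarrow> _)"
      by (simp add: Vector_Spaces.linear_iff vector_space_mult vector_space_axioms TI_unit_def
          scale_left_distrib)
    fix x y z :: "'a TI"
    show "TI_alpha (TI_vee x y) = TI_vee (TI_alpha x) (TI_alpha y)"
      by transfer (simp add: T_alpha_vee zero)
    show a: "TI_vee x (TI_unit 1) = TI_alpha x" "TI_vee (TI_unit 1) x = TI_alpha x" for x :: "'a TI"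
      unfolding TI_unit_1 by (transfer; simp add: T_vee_One_right T_vee_One_left zero)+
    show "TI_vee (TI_alpha x) (TI_vee y z) = TI_vee (TI_vee x y) (TI_alpha z)"
      using TI_hom_assoc[of x y z] a(2) by (simp add: TI_unit_1)
    show "TI_alpha (TI_unit 1 :: 'a TI) = TI_unit 1"
      unfolding TI_unit_1 by transfer (simp add: zero)
  qed (rule linear_TI_vee1 linear_TI_vee2 linear_TI_alpha)+
qed

text \<open>On \<open>\<bbbT>/\<I>\<close> the maps \<open>y \<otimes> z \<mapsto> \<epsilon> z y\<close> and \<open>y \<otimes> z \<mapsto> \<epsilon> y z\<close> are multiplicative because \<open>\<epsilon>\<close> is. Composed with
  the coproduct they are the identity on generators, hence everywhere.\<close>

lemma TI_counit:
  "tensor_lift TI_scale (\<lambda>y z. TI_scale (TI_eps z) y) (TI_Delta x) = x"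
  "tensor_lift TI_scale (\<lambda>y z. TI_scale (TI_eps y) z) (TI_Delta x) = x"
proof -
  interpret unital_hom_associative_algebra "TI_scale :: 'a \<Rightarrow> 'a TI \<Rightarrow> 'a TI" TI_vee TI_alpha TI_unit
    by (rule unital_hom_associative_algebra_TI)
  note V = vector_space_axioms
  obtain z where x: "x = abs_TI z" by (cases x)
  let ?r = "\<lambda>y z. TI_scale (TI_eps z) y :: 'a TI" and ?l = "\<lambda>y z. TI_scale (TI_eps y) z :: 'a TI"
  have lin: "Vector_Spaces.linear TI_scale TI_scale (\<lambda>y. ?r y z)"
      "Vector_Spaces.linear TI_scale TI_scale (?r z)" for z
    by (simp_all add: Vector_Spaces.linear_iff V linearD[OF linear_TI_eps] scale_right_distrib
        scale_left_distrib mult.commute)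
  have mult: "lin_ext TI_scale (\<lambda>(y, z). h y z) (comp_mult TI_vee u v)
      = TI_vee (lin_ext TI_scale (\<lambda>(y, z). h y z) u) (lin_ext TI_scale (\<lambda>(y, z). h y z) v)"
    if h: "\<And>y z y' z'. h (TI_vee y y') (TI_vee z z') = TI_vee (h y z) (h y' z')"
    for h :: "'a TI \<Rightarrow> 'a TI \<Rightarrow> 'a TI" and u v
    by (rule bilinear_gen_eqI[where s = TI_scale
          and f = "\<lambda>u v. lin_ext TI_scale (\<lambda>(y, z). h y z) (comp_mult TI_vee u v)"
          and g = "\<lambda>u v. TI_vee (lin_ext TI_scale (\<lambda>(y, z). h y z) u) (lin_ext TI_scale (\<lambda>(y, z). h y z) v)"])
      (rule linear_comp2[OF linear_comp_mult1 linear_lin_ext[OF V]]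
        linear_comp2[OF linear_comp_mult2 linear_lin_ext[OF V]]
        linear_comp2[OF linear_lin_ext[OF V] linear_TI_vee1]
        linear_comp2[OF linear_lin_ext[OF V] linear_TI_vee2] | clarsimp simp: lin_ext_gen[OF V] h)+
  have id: "lin_ext TI_scale (\<lambda>(y, z). h y z) (proj_Delta z) = abs_TI z"
    if h: "\<And>y z y' z'. h (TI_vee y y') (TI_vee z z') = TI_vee (h y z) (h y' z')"
      and "h TI_one TI_one = TI_one"
      and "\<And>a. h (abs_TI (gen (Tree (Leaf a)))) TI_one + h TI_one (abs_TI (gen (Tree (Leaf a))))
          = abs_TI (gen (Tree (Leaf a)))"
    for h :: "'a TI \<Rightarrow> 'a TI \<Rightarrow> 'a TI" and z
  proof (rule linear_gen_eqI[OF linear_comp2[OF linear_proj_Delta linear_lin_ext[OF V]] linear_abs_TI])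
    fix b
    show "lin_ext TI_scale (\<lambda>(y, z). h y z) (proj_Delta (gen b)) = abs_TI (gen b)"
    proof (induction b rule: basis_vee_induct)
      case One
      show ?case using that(2) by (simp add: proj_Delta_One lin_ext_gen[OF V] TI_one.abs_eq)
    next
      case (Leaf a)
      show ?case using that(3)
        by (simp add: proj_Delta_Leaf lin_ext_gen[OF V] linearD[OF linear_lin_ext[OF V]])
    next
      case (vee b c)
      then show ?case by (simp add: proj_Delta_basis_vee mult[of h, OF h] abs_TI_basis_vee)
    qed
  qed
  have eps: "TI_eps (TI_one :: 'a TI) = 1" "TI_eps (abs_TI (gen (Tree t)) :: 'a TI) = 0" for t
    by (simp_all add: TI_one.abs_eq TI_eps.abs_eq)
  note simps = TI_eps_vee linearD[OF linear_TI_vee1] linearD[OF linear_TI_vee2] eps mult.commute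
  show "tensor_lift TI_scale ?r (TI_Delta x) = x"
    unfolding x TI_Delta_abs_coset tensor_lift_coset[OF lin] by (rule id) (simp_all add: simps)
  show "tensor_lift TI_scale ?l (TI_Delta x) = x"
    unfolding x TI_Delta_abs_coset tensor_lift_coset[OF lin(2) lin(1)] by (rule id) (simp_all add: simps)
qed

lemma TI_Delta_one: "TI_Delta TI_one = tensor TI_scale TI_one TI_one"
  by (simp add: TI_one.abs_eq TI_Delta_abs_coset proj_Delta_One)

lemma hom_bialgebra_TI: "hom_bialgebra TI_scale TI_vee TI_alpha TI_unit TI_Delta id TI_eps"
proof -
  interpret unital_hom_associative_algebra "TI_scale :: 'a \<Rightarrow> 'a TI \<Rightarrow> 'a TI" TI_vee TI_alpha TI_unit
    by (rule unital_hom_associative_algebra_TI)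
  show ?thesis
  proof (intro hom_bialgebra.intro hom_bialgebra_axioms.intro counital_hom_coassociative_coalgebra.intro
      counital_hom_coassociative_coalgebra_axioms.intro vector_space_axioms
      unital_hom_associative_algebra_axioms)
    fix x y :: "'a TI"
    show "TI_Delta x \<in> tensor_space TI_scale"
      by (cases x) (simp add: TI_Delta_abs_coset tensor_space_def)
    show "TI_Delta (TI_vee x y) = tensor_mult TI_scale TI_vee (TI_Delta x) (TI_Delta y)"
      by (cases x; cases y)
        (simp add: TI_vee.abs_eq TI_Delta_abs_coset proj_Delta_vee
          tensor_mult_coset[OF linear_TI_vee1 linear_TI_vee2])
    show "TI_eps (TI_alpha x) = TI_eps x"
      by transfer (rule T_eps_alpha)
    show "TI_eps (TI_unit 1 :: 'a TI) = 1"
      unfolding TI_unit_1 by transfer simp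
    show "Vector_Spaces.linear TI_scale TI_scale (id :: 'a TI \<Rightarrow> 'a TI)"
      by (simp add: Vector_Spaces.linear_iff vector_space_axioms)
  qed (simp_all add: TI_Delta_add TI_Delta_scale linear_TI_eps TI_hom_coassoc TI_counit TI_unit_1
      TI_Delta_one TI_eps_vee)
qed

interpretation TI: hom_bialgebra TI_scale TI_vee TI_alpha TI_unit TI_Delta id TI_eps
  by (rule hom_bialgebra_TI)

lemma TI_S_vee: "TI_S (TI_vee x y) = TI_vee (TI_S y) (TI_S x)"
  by transfer (simp add: T_S_vee pm.subspace_0[OF subspace_hom_assoc_ideal])

lemma TI_S_one: "TI_S TI_one = TI_one"
  by transfer (simp add: pm.subspace_0[OF subspace_hom_assoc_ideal])

lemma TI_S_Leaf: "TI_S (abs_TI (gen (Tree (Leaf a)))) = - abs_TI (gen (Tree (Leaf a)))"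
  by (simp add: TI_S.abs_eq uminus_TI.abs_eq)

lemma TI_eps_S: "TI_eps (TI_S x) = TI_eps x"
proof transfer
  fix x :: "'a TT"
  show "T_eps (T_S x) = T_eps x"
  proof (rule linear_gen_eqI[OF linear_comp2[OF linear_T_S linear_T_eps] linear_T_eps])
    show "T_eps (T_S (gen b)) = (T_eps (gen b) :: 'a)" for b
    proof (induction b rule: basis_vee_induct)
      case (vee b c)
      then show ?case
        by (simp add: T_vee_gen[symmetric] T_S_vee T_eps_vee del: T_vee_gen)
    qed (simp_all add: T_eps_simps)
  qed
qed

text \<open>Only the generators are left after \<open>antipodal_at_mul\<close> and \<open>subspace_antipodal_at\<close>.\<close>

lemma antipodal_at_TI_S: "TI.antipodal_at TI_S x"
proof -
  note conv = TI.convolution_coset[OF _ _ TI_Delta_abs_coset]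
    and conv_one = TI.convolution_coset[OF _ _ TI_Delta_one]
  note V = vector_space_TI_scale
  note simps = lin_ext_gen[OF V] linearD[OF linear_lin_ext[OF V]]
    conv[OF linear_TI_S TI.linear_identity] conv[OF TI.linear_identity linear_TI_S]
  obtain z where "x = abs_TI z" by (cases x)
  moreover have "abs_TI z \<in> {x. TI.antipodal_at TI_S x}"
  proof (rule linear_gen_subspaceI[OF linear_abs_TI TI.subspace_antipodal_at[OF linear_TI_S]])
    fix b
    have "TI.antipodal_at TI_S (abs_TI (gen b))"
    proof (induction b rule: basis_vee_induct)
      case One
      show ?case unfolding TI.antipodal_at_def TI_one.abs_eq[symmetric]
        by (rule exI[of _ 0])
          (simp add: conv_one[OF linear_TI_S TI.linear_identity] conv_one[OF TI.linear_identity linear_TI_S]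
            lin_ext_gen[OF V] TI_S_one TI.unit_mul[unfolded TI_unit_1]
            TI.alpha_unit[unfolded TI_unit_1] TI.eps_unit[unfolded TI_unit_1] TI_unit_1)
    next
      case (Leaf a)
      show ?case unfolding TI.antipodal_at_def
        by (rule exI[of _ 0])
          (simp add: simps proj_Delta_Leaf TI_S_one TI_S_Leaf TI.unit_mul[unfolded TI_unit_1]
            TI.mul_unit[unfolded TI_unit_1] linearD[OF linear_TI_alpha] TI_eps.abs_eq
            linearD[OF TI.linear_eta])
    next
      case (vee b c)
      then show ?case
        unfolding abs_TI_basis_vee[symmetric] by (rule TI.antipodal_at_mul[OF linear_TI_S TI_S_vee])
    qed
    then show "abs_TI (gen b) \<in> {x. TI.antipodal_at TI_S x}" by simp
  qed
  ultimately show ?thesis by simp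
qed

lemma antipode_TI_S: "TI.antipode TI_S"
  unfolding TI.antipode_def
proof (intro conjI allI)
  show "TI_S \<circ> TI_alpha = (TI_alpha \<circ> TI_S :: 'a TI \<Rightarrow> _)"
  proof
    show "(TI_S \<circ> TI_alpha) x = (TI_alpha \<circ> TI_S) x" for x :: "'a TI"
      using TI_S_vee[of x TI_one]
      by (simp add: TI_S_one TI.mul_unit[unfolded TI_unit_1] TI.unit_mul[unfolded TI_unit_1])
  qed
  show "TI_S \<circ> TI_unit = (TI_unit :: 'a \<Rightarrow> _)"
    by (simp add: fun_eq_iff TI_unit_def linearD[OF linear_TI_S] TI_S_one)
  show "TI_eps \<circ> TI_S = (TI_eps :: 'a TI \<Rightarrow> _)"
    by (simp add: fun_eq_iff TI_eps_S)
  show "\<exists>k. (TI_alpha ^^ k) (TI.convolution TI_S id x) = TI_unit (TI_eps x)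
      \<and> (TI_alpha ^^ k) (TI.convolution id TI_S x) = TI_unit (TI_eps x)" for x :: "'a TI"
    using antipodal_at_TI_S[of x] unfolding TI.antipodal_at_def .
qed (rule linear_TI_S TI_S_vee)+

theorem theorem4p11:
  shows "hom_hopf_algebra (TI_scale :: 'k::field \<Rightarrow> 'k TI \<Rightarrow> 'k TI)
      TI_vee TI_alpha TI_unit TI_Delta id TI_eps
    \<and> hom_bialgebra.antipode (TI_scale :: 'k \<Rightarrow> 'k TI \<Rightarrow> 'k TI)
      TI_vee TI_alpha TI_unit TI_Delta TI_eps TI_S"
proof
  show "hom_hopf_algebra (TI_scale :: 'k \<Rightarrow> 'k TI \<Rightarrow> 'k TI) TI_vee TI_alpha TI_unit TI_Delta id TI_eps"
    by (intro hom_hopf_algebra.intro hom_hopf_algebra_axioms.intro hom_bialgebra_TI exI)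
      (rule antipode_TI_S)
qed (rule antipode_TI_S)

end
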